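(* Let $\mu$ be a finite (real, not necessarily positive) Borel measure in $\mathbb{C}$ whose logarithmic potential $$u(z)=\int_{\mathbb{C}}\log\frac{1}{|z-w|}\,d\mu(w),\quad z\in\mathbb{C},$$ makes sense, i.e. $\int_{\mathbb{C}}\log(1+|w|)\,d|\mu|(w)<\infty$. Then $u$ is differentiable in the capacity sense at $H^\psi$ almost all points of $\mathbb{C}$; that is, the set of points at which $u$ is not differentiable in the capacity sense has zero $H^\psi$ measure.
   Context: $B(a,r)$ is the disc of center $a$ and radius $r$; $\mathbb{C}$ is identified with $\mathbb{R}^2$. $\psi$ is the measure function $\psi(0)=0$, $\psi(t)=t\,\frac{1}{\log^2(1/t)}$ for $0<t\le e^{-1}$, $\psi(t)=t$ for $t\ge e^{-1}$, and $H^\psi$ is the associated Hausdorff measure, $H^\psi(E)=\lim_{\delta\to0}\inf\{\sum_i\psi(\operatorname{diam}E_i):E\subset\bigcup_iE_i,\ \operatorname{diam}E_i\le\delta\}$ (countable coverings). Wiener capacity: for a compact set $E$ contained in a disc of radius $1/2$, $\operatorname{Cap}(E)=\sup\nu(E)$, the supremum being over all positive finite Borel measures $\nu$ supported on $E$ with $\int\log\frac{1}{|z-w|}\,d\nu(w)\le1$ for all $z\in\mathbb{C}$. For a non-compact Borel set contained in a disc of radius $1/2$, $\operatorname{Cap}$ is the supremum of the capacities of its compact subsets. One has $\operatorname{Cap}(B(a,r))=1/\log(1/r)$ for $0<r<1/4$. Differentiability in the capacity sense: a real function $u$ is differentiable in the capacity sense at $a\in\mathbb{R}^2$ if there exist real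 numbers $A_1,A_2$ such that, with $Q(x)=\frac{|u(x)-u(a)-\sum_{i=1}^2A_i(x_i-a_i)|}{|x-a|}$, $$\lim_{r\to0}\frac{\sup_{t>0}t\,\operatorname{Cap}(\{x\in B(a,r):Q(x)>t\})}{\operatorname{Cap}(B(a,r))}=0.$$ In particular the integral defining $u(a)$ is required to converge absolutely. The potential $u$ is defined outside a set of capacity zero; points $x$ where it is not defined play no role in the definition. *)

theory Defs
  imports "HOL-Analysis.Analysis"
begin

section \<open>Finite signed Borel measures\<close>

text \<open>
  A finite signed Borel measure is a real-valued set function, countably additive on the Borel
  sets; its values on other sets are irrelevant.
\<close>

definition finite_signed_measure :: "('a::topological_space set \<Rightarrow> real) \<Rightarrow> bool" where
  "finite_signed_measure \<mu> \<longleftrightarrow>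
     \<mu> {} = 0 \<and>
     (\<forall>A::nat \<Rightarrow> 'a set. range A \<subseteq> sets borel \<longrightarrow> disjoint_family A \<longrightarrow>
        (\<lambda>n. \<mu> (A n)) sums \<mu> (\<Union>n. A n))"

text \<open>
  The Jordan parts of \<open>\<mu>\<close>. The coercion \<^const>\<open>ennreal\<close> sends negative numbers to 0, which does
  not affect the supremum because \<open>B = {}\<close> is admitted.
\<close>

definition upper_variation :: "('a::topological_space set \<Rightarrow> real) \<Rightarrow> 'a measure" where
  "upper_variation \<mu> =
     measure_of UNIV (sets borel) (\<lambda>A. SUP B\<in>{B \<in> sets borel. B \<subseteq> A}. ennreal (\<mu> B))"

definition lower_variation :: "('a::topological_space set \<Rightarrow> real) \<Rightarrow> 'a measure" where
  "lower_variation \<mu> = upper_variation (\<lambda>B. - \<mu> B)"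

definition total_variation :: "('a::topological_space set \<Rightarrow> real) \<Rightarrow> 'a measure" where
  "total_variation \<mu> =
     measure_of UNIV (sets borel)
       (\<lambda>A. emeasure (upper_variation \<mu>) A + emeasure (lower_variation \<mu>) A)"

text \<open>Meaningful when \<open>f\<close> is integrable with respect to the total variation.\<close>

definition signed_integral :: "('a::topological_space set \<Rightarrow> real) \<Rightarrow> ('a \<Rightarrow> real) \<Rightarrow> real" where
  "signed_integral \<mu> f =
     integral\<^sup>L (upper_variation \<mu>) f - integral\<^sup>L (lower_variation \<mu>) f"

section \<open>Logarithmic potentials\<close>

text \<open>The case distinction is needed because \<open>ln (1 / 0) = 0\<close> in HOL.\<close>

definition log_kernel :: "complex \<Rightarrow> complex \<Rightarrow> ereal" where
  "log_kernel z w = (if w = z then \<infinity> else ereal (ln (1 / cmod (z - w))))"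

definition potential_dom :: "(complex set \<Rightarrow> real) \<Rightarrow> complex set" where
  "potential_dom \<mu> =
     {z. (\<integral>\<^sup>+ w. e2ennreal \<bar>log_kernel z w\<bar> \<partial>total_variation \<mu>) < \<infinity>}"

text \<open>
  Only used on \<^const>\<open>potential_dom\<close>. There \<open>{z}\<close> is a null set of the total variation, so the
  value of the integrand at \<open>w = z\<close> is immaterial.
\<close>

definition log_potential :: "(complex set \<Rightarrow> real) \<Rightarrow> complex \<Rightarrow> real" where
  "log_potential \<mu> z = signed_integral \<mu> (\<lambda>w. ln (1 / cmod (z - w)))"

section \<open>Wiener capacity\<close>

text \<open>
  The potential of a positive measure as an extended real: positive part minus negative part.
  The negative part is finite for a finite measure with compact support.
\<close>

definition ext_log_potential :: "complex measure \<Rightarrow> complex \<Rightarrow> ereal" where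
  "ext_log_potential \<nu> z =
     enn2ereal (\<integral>\<^sup>+ w. e2ennreal (log_kernel z w) \<partial>\<nu>)
     - enn2ereal (\<integral>\<^sup>+ w. e2ennreal (- log_kernel z w) \<partial>\<nu>)"

text \<open>
  The capacity is intended for Borel sets contained in a disc of radius \<open>1/2\<close>; on other sets the
  definitions below are total but carry no meaning.
\<close>

definition compact_capacity :: "complex set \<Rightarrow> ennreal" where
  "compact_capacity E =
     (SUP \<nu>\<in>{\<nu>. sets \<nu> = sets borel \<and> finite_measure \<nu> \<and> emeasure \<nu> (UNIV - E) = 0 \<and>
               (\<forall>z. ext_log_potential \<nu> z \<le> 1)}. emeasure \<nu> E)"

definition capacity :: "complex set \<Rightarrow> ennreal" where
  "capacity E =
     (if compact E then compact_capacity E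
      else (SUP K\<in>{K. compact K \<and> K \<subseteq> E}. compact_capacity K))"

section \<open>Differentiability in the capacity sense\<close>

text \<open>
  Here \<open>u\<close> is a partial function with domain \<open>D\<close>. At \<open>x = a\<close> the quotient is \<open>0 / 0 = 0\<close>, so the
  point \<open>a\<close> never belongs to the sets whose capacity is taken.
\<close>

definition diff_quot :: "(complex \<Rightarrow> real) \<Rightarrow> complex \<Rightarrow> real \<Rightarrow> real \<Rightarrow> complex \<Rightarrow> real" where
  "diff_quot u a A1 A2 x =
     \<bar>u x - u a - (A1 * (Re x - Re a) + A2 * (Im x - Im a))\<bar> / cmod (x - a)"

definition capacity_differentiable ::
  "complex set \<Rightarrow> (complex \<Rightarrow> real) \<Rightarrow> complex \<Rightarrow> bool" where
  "capacity_differentiable D u a \<longleftrightarrow>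
     a \<in> D \<and>
     (\<exists>A1 A2.
        ((\<lambda>r. (SUP t\<in>{0<..}. ennreal t *
                  capacity {x \<in> ball a r. x \<in> D \<and> diff_quot u a A1 A2 x > t})
              / capacity (ball a r)) \<longlongrightarrow> 0) (at_right 0))"

section \<open>Hausdorff measures\<close>

text \<open>
  Countable coverings are sequences; finite ones are padded with empty sets, which contribute
  \<open>h 0\<close>, and this is 0 for a measure function. Boundedness is explicit because
  \<^const>\<open>diameter\<close> is unspecified on unbounded sets.
\<close>

definition hausdorff_content :: "(real \<Rightarrow> real) \<Rightarrow> real \<Rightarrow> 'a::metric_space set \<Rightarrow> ennreal" where
  "hausdorff_content h \<delta> E =
     (INF C\<in>{C::nat \<Rightarrow> 'a set. E \<subseteq> (\<Union>i. C i) \<and> (\<forall>i. bounded (C i) \<and> diameter (C i) \<le> \<delta>)}.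
        (\<Sum>i. ennreal (h (diameter (C i)))))"

definition hausdorff_measure :: "(real \<Rightarrow> real) \<Rightarrow> 'a::metric_space set \<Rightarrow> ennreal" where
  "hausdorff_measure h E = Lim (at_right 0) (\<lambda>\<delta>. hausdorff_content h \<delta> E)"

definition psi :: "real \<Rightarrow> real" where
  "psi t =
     (if t \<le> 0 then 0 else if t \<le> exp (- 1) then t * (1 / (ln (1 / t))\<^sup>2) else t)"

section \<open>Well-definedness\<close>

lemma hausdorff_measure_eq_SUP:
  "hausdorff_measure h E = (SUP \<delta>\<in>{0<..}. hausdorff_content h \<delta> E)"
proof -
  let ?f = "\<lambda>\<delta>. hausdorff_content h \<delta> E"
  have mono: "?f d' \<le> ?f d" if "d \<le> d'" for d d'
    unfolding hausdorff_content_def using that by (intro INF_superset_mono) (auto intro: order_trans)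
  have "(?f \<longlongrightarrow> (SUP \<delta>\<in>{0<..}. ?f \<delta>)) (at_right 0)"
  proof (rule order_tendstoI)
    fix a assume "a < (SUP \<delta>\<in>{0<..}. ?f \<delta>)"
    then obtain d where d: "d > 0" "a < ?f d" by (auto simp: less_SUP_iff)
    show "\<forall>\<^sub>F x in at_right 0. a < ?f x"
      unfolding eventually_at_right_field
      using d mono by (meson less_imp_le order.strict_trans2)
  next
    fix a assume a: "(SUP \<delta>\<in>{0<..}. ?f \<delta>) < a"
    have "?f x < a" if "x > 0" for x
      using a that by (meson SUP_upper greaterThan_iff order.strict_trans1)
    then show "\<forall>\<^sub>F x in at_right 0. ?f x < a"
      by (auto simp: eventually_at_right_field intro!: exI[of _ 1])
  qed
  then show ?thesis
    unfolding hausdorff_measure_def by (intro tendsto_Lim) simp_all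
qed

lemma emeasure_upper_variation:
  fixes \<mu> :: "'a::topological_space set \<Rightarrow> real"
  assumes \<mu>: "finite_signed_measure \<mu>" and A: "A \<in> sets borel"
  shows "emeasure (upper_variation \<mu>) A = (SUP B\<in>{B \<in> sets borel. B \<subseteq> A}. ennreal (\<mu> B))"
proof -
  let ?v = "\<lambda>A. SUP B\<in>{B \<in> sets borel. B \<subseteq> A}. ennreal (\<mu> B)"
  have empty: "\<mu> {} = 0"
    and sums: "\<And>A::nat \<Rightarrow> 'a set. range A \<subseteq> sets borel \<Longrightarrow> disjoint_family A \<Longrightarrow>
        (\<lambda>n. \<mu> (A n)) sums \<mu> (\<Union>n. A n)"
    using \<mu> by (auto simp: finite_signed_measure_def)
  have add: "\<mu> (B \<union> C) = \<mu> B + \<mu> C"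
    if BC: "B \<in> sets borel" "C \<in> sets borel" "B \<inter> C = {}" for B C
  proof -
    have "(\<lambda>n. \<mu> (binaryset B C n)) sums \<mu> (\<Union>n. binaryset B C n)"
      using BC by (intro sums) (auto simp: binaryset_def disjoint_family_on_def)
    then have "(\<lambda>n. \<mu> (binaryset B C n)) sums \<mu> (B \<union> C)"
      by (simp add: UN_binaryset_eq)
    with binaryset_sums[of \<mu> B C] empty show ?thesis
      using sums_unique2 by blast
  qed
  have sup_add: "?v B + ?v C \<le> ?v (B \<union> C)"
    if BC: "B \<inter> C = {}" for B C
  proof -
    have *: "ennreal (\<mu> X) + ennreal (\<mu> Y) \<le> ?v (B \<union> C)"
      if X: "X \<in> sets borel" "X \<subseteq> B" and Y: "Y \<in> sets borel" "Y \<subseteq> C" for X Y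
    proof -
      have 1: "ennreal (\<mu> X) \<le> ?v (B \<union> C)" using X by (intro SUP_upper) auto
      have 2: "ennreal (\<mu> Y) \<le> ?v (B \<union> C)" using Y by (intro SUP_upper) auto
      have "ennreal (\<mu> X + \<mu> Y) = ennreal (\<mu> (X \<union> Y))"
        using X Y BC by (subst add) auto
      also have "\<dots> \<le> ?v (B \<union> C)" using X Y by (intro SUP_upper) auto
      finally have 3: "ennreal (\<mu> X + \<mu> Y) \<le> ?v (B \<union> C)" .
      consider "\<mu> X \<le> 0" | "\<mu> Y \<le> 0" | "\<mu> X \<ge> 0" "\<mu> Y \<ge> 0" by linarith
      then show ?thesis
        using 1 2 3 by cases (auto simp: ennreal_neg)
    qed
    have ne: "{X \<in> sets borel. X \<subseteq> D} \<noteq> {}" for D :: "'a set" by auto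
    have **: "?v B + ennreal (\<mu> Y) \<le> ?v (B \<union> C)" if "Y \<in> sets borel" "Y \<subseteq> C" for Y
      using that * by (subst ennreal_SUP_add_left[OF ne, symmetric]) (auto intro!: SUP_least)
    show ?thesis
      unfolding ennreal_SUP_add_right[OF ne] by (rule SUP_least, rule **) simp_all
  qed
  have mono: "?v B \<le> ?v C" if "B \<subseteq> C" for B C
    using that by (intro SUP_subset_mono) auto
  have "countably_additive (sets borel) ?v"
    unfolding countably_additive_def
  proof (intro allI impI antisym)
    fix F :: "nat \<Rightarrow> 'a set"
    assume F: "range F \<subseteq> sets borel" "disjoint_family F"
    have part: "(\<Sum>i<n. ?v (F i)) \<le> ?v (\<Union>i<n. F i)" for n
    proof (induction n)
      case (Suc n)
      have disj: "(\<Union>i<n. F i) \<inter> F n = {}"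
      proof -
        have "F i \<inter> F n = {}" if "i < n" for i
          using that by (intro disjoint_family_onD[OF F(2)]) auto
        then show ?thesis by blast
      qed
      have "(\<Sum>i<Suc n. ?v (F i)) \<le> ?v (\<Union>i<n. F i) + ?v (F n)"
        unfolding sum.lessThan_Suc by (intro add_right_mono Suc.IH)
      also have "\<dots> \<le> ?v ((\<Union>i<n. F i) \<union> F n)"
        by (rule sup_add[OF disj])
      also have "(\<Union>i<n. F i) \<union> F n = (\<Union>i<Suc n. F i)"
        by (simp add: lessThan_Suc Un_commute)
      finally show ?case .
    qed simp
    show "(\<Sum>i. ?v (F i)) \<le> ?v (\<Union> (range F))"
    proof (rule suminf_le_const)
      show "(\<Sum>i<n. ?v (F i)) \<le> ?v (\<Union> (range F))" for n
        by (rule order_trans[OF part mono]) auto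
    qed auto
    show "?v (\<Union> (range F)) \<le> (\<Sum>i. ?v (F i))"
    proof (rule SUP_least, clarify)
      fix B assume B: "B \<in> sets borel" "B \<subseteq> \<Union> (range F)"
      have "(\<lambda>n. \<mu> (B \<inter> F n)) sums \<mu> (\<Union>n. B \<inter> F n)"
        using F B by (intro sums) (auto simp: disjoint_family_on_def)
      moreover have "(\<Union>n. B \<inter> F n) = B" using B by auto
      ultimately have s: "(\<lambda>n. \<mu> (B \<inter> F n)) sums \<mu> B" by simp
      have "ennreal (\<Sum>i<n. \<mu> (B \<inter> F i)) \<le> (\<Sum>i. ?v (F i))" for n
      proof -
        have "ennreal (\<Sum>i<n. \<mu> (B \<inter> F i)) \<le> ennreal (\<Sum>i<n. max 0 (\<mu> (B \<inter> F i)))"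
          by (intro ennreal_leI sum_mono) auto
        also have "\<dots> = (\<Sum>i<n. ennreal (max 0 (\<mu> (B \<inter> F i))))"
          by (subst sum_ennreal) auto
        also have "\<dots> \<le> (\<Sum>i<n. ?v (F i))"
        proof (rule sum_mono)
          fix i
          have "ennreal (max 0 (\<mu> (B \<inter> F i))) = ennreal (\<mu> (B \<inter> F i))"
            by (auto simp: max_def ennreal_neg)
          also have "\<dots> \<le> ?v (F i)" using B F by (intro SUP_upper) auto
          finally show "ennreal (max 0 (\<mu> (B \<inter> F i))) \<le> ?v (F i)" .
        qed
        also have "\<dots> \<le> (\<Sum>i. ?v (F i))" by (intro sum_le_suminf) auto
        finally show ?thesis .
      qed
      moreover have "(\<lambda>n. ennreal (\<Sum>i<n. \<mu> (B \<inter> F i))) \<longlonglongrightarrow> ennreal (\<mu> B)"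
        using s by (intro tendsto_ennrealI) (simp add: sums_def)
      ultimately show "ennreal (\<mu> B) \<le> (\<Sum>i. ?v (F i))"
        by (intro LIMSEQ_le_const2) auto
    qed
  qed
  moreover have "positive (sets borel) ?v"
    by (auto simp: positive_def empty)
  ultimately show ?thesis
    using A sets.sigma_algebra_axioms[of "borel :: 'a measure"]
    unfolding upper_variation_def by (intro emeasure_measure_of_sigma) auto
qed

lemma sets_variations [simp]:
  "sets (upper_variation \<mu>) = sets borel"
  "sets (lower_variation \<mu>) = sets borel"
  "sets (total_variation \<mu>) = sets borel"
  using sets.sigma_sets_eq[of borel]
  by (auto simp: upper_variation_def lower_variation_def total_variation_def)

lemma emeasure_total_variation:
  fixes \<mu> :: "'a::topological_space set \<Rightarrow> real"
  assumes "A \<in> sets borel"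
  shows "emeasure (total_variation \<mu>) A =
    emeasure (upper_variation \<mu>) A + emeasure (lower_variation \<mu>) A"
proof -
  let ?v = "\<lambda>A. emeasure (upper_variation \<mu>) A + emeasure (lower_variation \<mu>) A"
  have "countably_additive (sets borel) ?v"
    unfolding countably_additive_def
  proof (intro allI impI)
    fix F :: "nat \<Rightarrow> 'a set"
    assume "range F \<subseteq> sets borel" "disjoint_family F"
    then show "(\<Sum>i. ?v (F i)) = ?v (\<Union> (range F))"
      by (subst suminf_add[symmetric]) (auto simp: suminf_emeasure)
  qed
  moreover have "positive (sets borel) ?v"
    by (auto simp: positive_def)
  ultimately show ?thesis
    using assms sets.sigma_algebra_axioms[of "borel :: 'a measure"]
    unfolding total_variation_def by (intro emeasure_measure_of_sigma) auto
qed

end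

theory Submission
  imports Defs "HOL-Real_Asymp.Real_Asymp"
begin

text \<open>
  Let \<open>m\<close> be the total variation of \<open>\<mu>\<close>. Fix a point \<open>a\<close>, put \<open>y = x - a\<close> and \<open>v = w - a\<close>, and subtract from
  the kernel \<open>ln (1 / \<bar>y - v\<bar>)\<close> its value and its linear part at \<open>y = 0\<close>. The remainder is bounded by a
  constant times \<open>(\<bar>y\<bar> / \<bar>v\<bar>) min 1 (\<bar>y\<bar> / \<bar>v\<bar>)\<close>, plus the positive part of \<open>ln (2 \<bar>y\<bar> / \<bar>y - v\<bar>)\<close> for
  \<open>\<bar>v\<bar> < 2 \<bar>y\<bar>\<close> (\<open>log_expansion_remainder_bound\<close>). The integral of the first term is \<open>o(\<bar>y\<bar>)\<close> as soon as
  \<open>1 / \<bar>v\<bar>\<close> is \<open>m\<close>-integrable.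

  The gauge enters through densities. By a Vitali covering argument, outside a set of \<open>H\<^sup>\<psi>\<close> measure zero
  every point satisfies \<open>m (B(a, r)) \<le> N \<psi>(r)\<close> for some \<open>N\<close> and all small \<open>r\<close>. Summation over exponentially
  shrinking balls then gives \<open>\<integral>\<^bsub>B(a, r)\<^esub> 1 / \<bar>v\<bar> dm = O(1 / ln (1 / r))\<close> (\<open>nn_integral_inverse_dist_le\<close>).
  In particular \<open>1 / \<bar>v\<bar>\<close> is integrable. The bound has the same order as \<open>Cap (B(a, r))\<close>.

  The logarithmic singularity is not uniformly small and is measured by capacity. After division by
  \<open>\<bar>y\<bar>\<close> it is at most the potential of the measure with density \<open>2 / \<bar>v\<bar>\<close> on \<open>B(a, 2 r)\<close>. The weak type
  inequality bounds \<open>t Cap {potential > t}\<close> by the mass of that measure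
  (\<open>mult_compact_capacity_le_of_potential_ge\<close>), which is \<open>O(1 / ln (1 / r))\<close>, whereas
  \<open>o(1 / ln (1 / r))\<close> is needed. For this reason \<open>m\<close> is split along the set \<open>F\<close> of points that satisfy the
  density bound with a common \<open>N\<close>. The restriction of \<open>m\<close> to \<open>F\<close> obeys such a bound on all small balls of
  the plane, not only on those with centre in \<open>F\<close>, so its logarithmic term is \<open>O(\<psi>(4 \<bar>y\<bar>)) = o(\<bar>y\<bar>)\<close> at
  every \<open>x\<close> (\<open>nn_integral_log_restrict_le\<close>). The restriction of \<open>m\<close> to the complement of \<open>F\<close> has density 0
  with respect to \<open>\<psi>\<close> at \<open>H\<^sup>\<psi>\<close> almost every point of \<open>F\<close>
  (\<open>hausdorff_measure_psi_dense_null_set_eq_0\<close>), which improves the \<open>O\<close> to the required \<open>o\<close>.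
\<close>

section \<open>The variation measures of a finite signed measure\<close>

lemma signed_measure_Diff:
  assumes \<mu>: "finite_signed_measure \<mu>" and "A \<in> sets borel" "B \<in> sets borel" "B \<subseteq> A"
  shows "\<mu> (A - B) = \<mu> A - \<mu> B"
proof -
  let ?F = "binaryset (A - B) B"
  have empty: "\<mu> {} = 0" using \<mu> by (simp add: finite_signed_measure_def)
  have "range ?F \<subseteq> sets borel" "disjoint_family ?F"
    using assms(2,3) by (auto simp: binaryset_def disjoint_family_on_def)
  then have "(\<lambda>n. \<mu> (?F n)) sums \<mu> (\<Union>n. ?F n)"
    using \<mu> unfolding finite_signed_measure_def by blast
  then have "(\<lambda>n. \<mu> (?F n)) sums \<mu> A"
    using assms(4) by (simp add: UN_binaryset_eq Un_absorb2)
  with binaryset_sums[of \<mu> "A - B" B] empty show ?thesis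
    using sums_unique2 by fastforce
qed

text \<open>
  A real-valued countably additive set function is bounded above. If the upper variation of \<open>A\<close> is
  infinite, then some \<open>B \<subseteq> A\<close> has \<open>\<mu> B > \<bar>\<mu> A\<bar> + 1\<close>, so that both \<open>\<mu> B\<close> and \<open>\<mu> (A - B)\<close> have
  absolute value above 1, and one of \<open>B\<close>, \<open>A - B\<close> again has infinite upper variation. Passing to
  that one forever splits off disjoint pieces whose values do not tend to 0.
\<close>
lemma emeasure_upper_variation_UNIV_finite:
  fixes \<mu> :: "'a::topological_space set \<Rightarrow> real"
  assumes \<mu>: "finite_signed_measure \<mu>"
  shows "emeasure (upper_variation \<mu>) UNIV < \<infinity>"
proof (rule ccontr)
  let ?v = "emeasure (upper_variation \<mu>)"
  assume "\<not> ?thesis"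
  then have inf: "?v UNIV = \<infinity>" by (simp add: less_top[symmetric])
  define Q where "Q A \<longleftrightarrow> A \<in> sets borel \<and> ?v A = \<infinity>" for A
  have step: "\<exists>A'. Q A' \<and> A' \<subseteq> A \<and> \<bar>\<mu> (A - A')\<bar> \<ge> 1" if "Q A" for A
  proof -
    have A: "A \<in> sets borel" "?v A = \<infinity>" using that by (auto simp: Q_def)
    have "ennreal (\<bar>\<mu> A\<bar> + 1) < ?v A" using A by simp
    then obtain B where B: "B \<in> sets borel" "B \<subseteq> A" and "ennreal (\<bar>\<mu> A\<bar> + 1) < ennreal (\<mu> B)"
      unfolding emeasure_upper_variation[OF \<mu> A(1)] less_SUP_iff by blast
    then have big: "\<bar>\<mu> A\<bar> + 1 < \<mu> B" by (subst (asm) ennreal_less_iff) auto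
    have "?v B + ?v (A - B) = ?v A"
      using A B by (subst plus_emeasure) (auto simp: Un_absorb1)
    then have "?v B = \<infinity> \<or> ?v (A - B) = \<infinity>" using A by (auto simp: ennreal_add_eq_top)
    then show ?thesis
    proof
      assume "?v B = \<infinity>"
      then show ?thesis
        using A B big signed_measure_Diff[OF \<mu> A(1) B] by (intro exI[of _ B]) (auto simp: Q_def)
    next
      assume "?v (A - B) = \<infinity>"
      moreover have "A - (A - B) = B" using B by auto
      ultimately show ?thesis
        using A B big by (intro exI[of _ "A - B"]) (auto simp: Q_def)
    qed
  qed
  have "\<exists>f. \<forall>n. Q (f n) \<and> (f (Suc n) \<subseteq> f n \<and> \<bar>\<mu> (f n - f (Suc n))\<bar> \<ge> 1)"
    by (rule dependent_nat_choice) (use inf step in \<open>auto simp: Q_def\<close>)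
  then obtain f where f: "\<And>n. Q (f n)" "\<And>n. f (Suc n) \<subseteq> f n" "\<And>n. \<bar>\<mu> (f n - f (Suc n))\<bar> \<ge> 1"
    by blast
  have dec: "f n \<subseteq> f k" if "k \<le> n" for k n
    using lift_Suc_antimono_le[of f, OF f(2) that] .
  have "disjoint_family (\<lambda>n. f n - f (Suc n))"
    unfolding disjoint_family_on_def
  proof (intro ballI impI)
    fix i j :: nat assume "i \<noteq> j"
    then have "Suc i \<le> j \<or> Suc j \<le> i" by linarith
    then show "(f i - f (Suc i)) \<inter> (f j - f (Suc j)) = {}" using dec[of "Suc i" j] dec[of "Suc j" i] by auto
  qed
  moreover have "range (\<lambda>n. f n - f (Suc n)) \<subseteq> sets borel" using f(1) by (auto simp: Q_def)
  ultimately have "summable (\<lambda>n. \<mu> (f n - f (Suc n)))"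
    using \<mu> unfolding finite_signed_measure_def sums_iff by blast
  then have "(\<lambda>n. \<mu> (f n - f (Suc n))) \<longlonglongrightarrow> 0" by (rule summable_LIMSEQ_zero)
  then have "\<forall>\<^sub>F n in sequentially. \<bar>\<mu> (f n - f (Suc n))\<bar> < 1"
    using tendsto_rabs_zero order_tendstoD(2) zero_less_one by blast
  then obtain n where "\<bar>\<mu> (f n - f (Suc n))\<bar> < 1" by (auto simp: eventually_sequentially)
  then show False using f(3)[of n] by simp
qed

lemma finite_signed_measure_uminus:
  "finite_signed_measure \<mu> \<Longrightarrow> finite_signed_measure (\<lambda>B. - \<mu> B)"
  unfolding finite_signed_measure_def by (auto intro: sums_minus)

lemma finite_measure_total_variation:
  fixes \<mu> :: "'a::topological_space set \<Rightarrow> real"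
  assumes "finite_signed_measure \<mu>"
  shows "finite_measure (total_variation \<mu>)"
proof
  have "space (total_variation \<mu>) = UNIV" using sets_eq_imp_space_eq[OF sets_variations(3)] by simp
  then show "emeasure (total_variation \<mu>) (space (total_variation \<mu>)) \<noteq> \<infinity>"
    using emeasure_upper_variation_UNIV_finite[OF assms]
      emeasure_upper_variation_UNIV_finite[OF finite_signed_measure_uminus[OF assms]]
    by (simp add: emeasure_total_variation lower_variation_def ennreal_add_eq_top less_top)
qed

text \<open>
  Through this identity every estimate below involves only one positive measure, the total variation.
\<close>
lemma nn_integral_total_variation:
  fixes \<mu> :: "'a::topological_space set \<Rightarrow> real"
  assumes "f \<in> borel_measurable borel"
  shows "(\<integral>\<^sup>+x. f x \<partial>total_variation \<mu>) =
    (\<integral>\<^sup>+x. f x \<partial>upper_variation \<mu>) + (\<integral>\<^sup>+x. f x \<partial>lower_variation \<mu>)"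
proof -
  have sets [measurable_cong]: "sets (upper_variation \<mu>) = sets borel"
    "sets (lower_variation \<mu>) = sets borel" "sets (total_variation \<mu>) = sets borel" by simp_all
  show ?thesis using assms
  proof (induction rule: borel_measurable_induct)
    case (cong f g)
    then show ?case by (simp add: space_borel cong: nn_integral_cong_simp)
  next
    case (set A)
    then show ?case by (simp add: emeasure_total_variation)
  next
    case (mult u c)
    note [measurable] = \<open>u \<in> borel_measurable borel\<close>
    show ?case using mult.IH by (simp add: nn_integral_cmult distrib_left)
  next
    case (add u v)
    note [measurable] = \<open>u \<in> borel_measurable borel\<close> \<open>v \<in> borel_measurable borel\<close>
    show ?case using add.IH by (simp add: nn_integral_add ac_simps)
  next
    case (seq U)
    note [measurable] = \<open>\<And>i. U i \<in> borel_measurable borel\<close>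
    have *: "(\<integral>\<^sup>+x. (SUP i. U i x) \<partial>M) = (SUP i. \<integral>\<^sup>+x. U i x \<partial>M)" if "sets M = sets borel" for M
      using \<open>incseq U\<close> that measurable_cong_sets[OF that refl]
      by (intro nn_integral_monotone_convergence_SUP) auto
    show ?case unfolding SUP_apply image_comp comp_def * [OF sets(1)] * [OF sets(2)] * [OF sets(3)] seq.IH
      using \<open>incseq U\<close>
      by (subst ennreal_SUP_add) (auto simp: incseq_def le_fun_def intro!: nn_integral_mono)
  qed
qed

lemma signed_integral_bound:
  fixes \<mu> :: "'a::topological_space set \<Rightarrow> real"
  assumes [measurable]: "f \<in> borel_measurable borel"
  shows "ennreal \<bar>signed_integral \<mu> f\<bar> \<le> (\<integral>\<^sup>+x. ennreal \<bar>f x\<bar> \<partial>total_variation \<mu>)"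
proof -
  have bound: "ennreal \<bar>integral\<^sup>L M f\<bar> \<le> (\<integral>\<^sup>+x. ennreal \<bar>f x\<bar> \<partial>M)" if "sets M = sets borel" for M
  proof (cases "integrable M f")
    case True
    then show ?thesis using integral_norm_bound_ennreal[of M f] by simp
  qed (simp add: not_integrable_integral_eq)
  have "ennreal \<bar>signed_integral \<mu> f\<bar> \<le>
      ennreal (\<bar>integral\<^sup>L (upper_variation \<mu>) f\<bar> + \<bar>integral\<^sup>L (lower_variation \<mu>) f\<bar>)"
    unfolding signed_integral_def by (intro ennreal_leI) simp
  also have "\<dots> \<le> (\<integral>\<^sup>+x. ennreal \<bar>f x\<bar> \<partial>total_variation \<mu>)"
    by (simp add: nn_integral_total_variation add_mono bound)
  finally show ?thesis .
qed

lemma integrable_total_variation: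
  fixes \<mu> :: "'a::topological_space set \<Rightarrow> real" and f :: "'a \<Rightarrow> real"
  assumes f [measurable]: "f \<in> borel_measurable borel"
    and fin: "(\<integral>\<^sup>+x. ennreal \<bar>f x\<bar> \<partial>total_variation \<mu>) < \<infinity>"
  shows "integrable (upper_variation \<mu>) f" "integrable (lower_variation \<mu>) f"
proof -
  have [measurable_cong]: "sets (upper_variation \<mu>) = sets borel"
    "sets (lower_variation \<mu>) = sets borel" by simp_all
  have "(\<integral>\<^sup>+x. ennreal \<bar>f x\<bar> \<partial>upper_variation \<mu>) + (\<integral>\<^sup>+x. ennreal \<bar>f x\<bar> \<partial>lower_variation \<mu>) < \<infinity>"
    using fin by (subst (asm) nn_integral_total_variation) auto
  then show "integrable (upper_variation \<mu>) f" "integrable (lower_variation \<mu>) f"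
    by (auto intro!: integrableI_bounded simp: less_top)
qed

section \<open>Sets of Hausdorff measure zero\<close>

lemma hausdorff_measure_eq_0_iff:
  "hausdorff_measure h E = 0 \<longleftrightarrow> (\<forall>\<delta>>0. hausdorff_content h \<delta> E = 0)"
  unfolding hausdorff_measure_eq_SUP 
  using SUP_bot_conv(1)[of "\<lambda>\<delta>. hausdorff_content h \<delta> E" "{0<..}"]
  by (simp add: bot_ennreal Ball_def)

lemma hausdorff_content_mono: "E \<subseteq> F \<Longrightarrow> hausdorff_content h \<delta> E \<le> hausdorff_content h \<delta> F"
  unfolding hausdorff_content_def by (intro INF_superset_mono) auto

lemma hausdorff_measure_0_mono:
  "hausdorff_measure h F = 0 \<Longrightarrow> E \<subseteq> F \<Longrightarrow> hausdorff_measure h E = 0"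
  unfolding hausdorff_measure_eq_0_iff using hausdorff_content_mono[of E F h] by (metis le_zero_eq)

lemma hausdorff_measure_0_UN:
  fixes E :: "nat \<Rightarrow> 'a::metric_space set"
  assumes "\<And>n. hausdorff_measure h (E n) = 0"
  shows "hausdorff_measure h (\<Union>n. E n) = 0"
  unfolding hausdorff_measure_eq_0_iff
proof (intro allI impI)
  fix \<delta> :: real assume "\<delta> > 0"
  have small: "hausdorff_content h \<delta> (\<Union>n. E n) \<le> ennreal e" if "e > 0" for e
  proof -
    have "\<exists>C::nat \<Rightarrow> 'a set. E n \<subseteq> (\<Union>i. C i) \<and> (\<forall>i. bounded (C i) \<and> diameter (C i) \<le> \<delta>) \<and>
        (\<Sum>i. ennreal (h (diameter (C i)))) \<le> ennreal (e * (1/2) ^ Suc n)" for n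
    proof -
      have "hausdorff_content h \<delta> (E n) < ennreal (e * (1/2) ^ Suc n)"
        using assms[of n] \<open>\<delta> > 0\<close> \<open>e > 0\<close> by (simp add: hausdorff_measure_eq_0_iff)
      then show ?thesis unfolding hausdorff_content_def INF_less_iff by (auto intro: less_imp_le)
    qed
    then obtain C :: "nat \<Rightarrow> nat \<Rightarrow> 'a set" where C:
      "\<And>n. E n \<subseteq> (\<Union>i. C n i)" "\<And>n i. bounded (C n i)" "\<And>n i. diameter (C n i) \<le> \<delta>"
      "\<And>n. (\<Sum>i. ennreal (h (diameter (C n i)))) \<le> ennreal (e * (1/2) ^ Suc n)"
      by metis
    define D where "D k = (case prod_decode k of (n, i) \<Rightarrow> C n i)" for k
    have "(\<Union>n. E n) \<subseteq> (\<Union>k. D k)"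
    proof
      fix x assume "x \<in> (\<Union>n. E n)"
      then obtain n i where "x \<in> C n i" using C(1) by blast
      then have "x \<in> D (prod_encode (n, i))" by (simp add: D_def)
      then show "x \<in> (\<Union>k. D k)" by blast
    qed
    moreover have "bounded (D k) \<and> diameter (D k) \<le> \<delta>" for k
      using C(2,3) by (simp add: D_def split: prod.split)
    ultimately have "hausdorff_content h \<delta> (\<Union>n. E n) \<le> (\<Sum>k. ennreal (h (diameter (D k))))"
      unfolding hausdorff_content_def by (intro INF_lower) auto
    also have "\<dots> = (\<Sum>n. \<Sum>i. ennreal (h (diameter (C n i))))"
      using suminf_ennreal_2dimen[of "\<lambda>n. \<Sum>i. ennreal (h (diameter (C n i)))"
          "\<lambda>(n, i). ennreal (h (diameter (C n i)))"]
      by (simp add: D_def comp_def split_def)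
    also have "\<dots> \<le> (\<Sum>n. ennreal (e * (1/2) ^ Suc n))"
      by (intro suminf_le C(4)) auto
    also have "\<dots> = ennreal e"
      using sums_mult[OF power_half_series, of e] \<open>e > 0\<close> by (intro suminf_ennreal_eq) auto
    finally show ?thesis .
  qed
  have "hausdorff_content h \<delta> (\<Union>n. E n) \<le> 0"
    by (rule ennreal_le_epsilon) (simp add: small)
  then show "hausdorff_content h \<delta> (\<Union>n. E n) = 0" by simp
qed

section \<open>The gauge and its densities\<close>

lemma psi_eq: "0 < t \<Longrightarrow> t \<le> exp (- 1) \<Longrightarrow> psi t = t / (ln t)\<^sup>2"
  by (simp add: psi_def ln_div)

lemma psi_nonneg: "0 \<le> psi t"
  by (simp add: psi_def)

lemma psi_le: "0 < t \<Longrightarrow> t \<le> exp (- 1) \<Longrightarrow> psi t \<le> t"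
proof -
  assume t: "0 < t" "t \<le> exp (- 1)"
  then have "1 \<le> \<bar>ln t\<bar>" using ln_mono[of t "exp (-1)"] by simp
  then have "1 \<le> (ln t)\<^sup>2" using abs_le_square_iff[of 1 "ln t"] by simp
  then have "t / (ln t)\<^sup>2 \<le> t / 1" using t by (intro divide_left_mono) auto
  then show ?thesis using t by (simp add: psi_eq)
qed

text \<open>
  The ratio \<open>psi t / t\<close> increases up to \<open>1 / e\<close>; hence the values at the radii \<open>t / 2 ^ k\<close> are
  dominated by a geometric series.
\<close>
lemma psi_mult_le:
  assumes "0 < c" "c \<le> 1" "0 < t" "t \<le> exp (- 1)"
  shows "psi (c * t) \<le> c * psi t"
proof -
  have le: "c * t \<le> t" using assms by simp
  have "ln (c * t) \<le> ln t" using le assms by simp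
  moreover have lt: "ln t \<le> - 1" using assms ln_mono[of t "exp (-1)"] by simp
  ultimately have "(ln t)\<^sup>2 \<le> (ln (c * t))\<^sup>2" by (simp add: abs_le_square_iff[symmetric])
  moreover have pos: "(ln t)\<^sup>2 > 0" using lt by simp
  ultimately have "c * t / (ln (c * t))\<^sup>2 \<le> c * t / (ln t)\<^sup>2"
    using assms by (intro divide_left_mono mult_pos_pos) auto
  then show ?thesis using assms le psi_eq[of "c * t"] psi_eq[of t]
    by (simp add: order_trans[OF le])
qed

lemma psi_10_le:
  assumes "0 < r" "r \<le> 1 / 100"
  shows "psi (10 * r) \<le> 40 * psi r"
proof -
  have e: "1 / 3 \<le> exp (- 1 :: real)" using exp_le by (simp add: exp_minus divide_simps)
  have "ln r \<le> ln (1 / 100)" using assms by (subst ln_le_cancel_iff) auto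
  also have "ln (1 / 100 :: real) = - 2 * ln 10"
    using ln_realpow[of "10::real" 2] by (simp add: ln_div)
  finally have "2 * ln 10 \<le> - ln r" by simp
  moreover have "ln (10 * r) = ln 10 + ln r" using assms by (simp add: ln_mult)
  moreover have "0 < ln (10::real)" by simp
  ultimately have "\<bar>ln r / 2\<bar> \<le> \<bar>ln (10 * r)\<bar>" and pos: "ln r < 0" by linarith+
  then have "(ln r / 2)\<^sup>2 \<le> (ln (10 * r))\<^sup>2" by (simp only: abs_le_square_iff)
  then have "10 * r / (ln (10 * r))\<^sup>2 \<le> 10 * r / (ln r / 2)\<^sup>2"
    using assms pos by (intro divide_left_mono) auto
  also have "\<dots> = 40 * (r / (ln r)\<^sup>2)" by (simp add: power2_eq_square field_simps)
  finally show ?thesis using assms e by (simp add: psi_eq)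
qed

text \<open>
  Vitali's covering lemma selects disjoint balls \<open>B(a, r)\<close> inside \<open>U\<close>, each carrying mass at least
  \<open>\<eta> psi r\<close>, whose fivefold enlargements still cover \<open>A\<close>. The enlargements have diameter \<open>10 r\<close>,
  and enlarging the radius by 10 costs the factor 40 of \<open>psi_10_le\<close>.
\<close>
lemma hausdorff_content_psi_le_of_dense_balls:
  fixes M :: "'a::euclidean_space measure"
  assumes M: "sets M = sets borel" and U: "open U" "A \<subseteq> U" and "\<eta> > 0" "\<delta> > 0"
    and dense: "\<And>a \<epsilon>. a \<in> A \<Longrightarrow> \<epsilon> > 0 \<Longrightarrow> \<exists>r. 0 < r \<and> r < \<epsilon> \<and> ennreal (\<eta> * psi r) \<le> emeasure M (ball a r)"
  shows "hausdorff_content psi \<delta> A \<le> ennreal (40 / \<eta>) * emeasure M U"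
proof -
  have "\<exists>r. 0 < r \<and> r \<le> \<delta> / 10 \<and> r \<le> 1 / 100 \<and> ball a r \<subseteq> U \<and> ennreal (\<eta> * psi r) \<le> emeasure M (ball a r)"
    if "a \<in> A" for a
  proof -
    have "a \<in> U" using U(2) that by auto
    then obtain e where e: "e > 0" "ball a e \<subseteq> U" by (rule openE[OF U(1)])
    obtain r where r: "0 < r" "r < min e (min (\<delta> / 10) (1 / 100))" "ennreal (\<eta> * psi r) \<le> emeasure M (ball a r)"
      using dense[OF \<open>a \<in> A\<close>, of "min e (min (\<delta> / 10) (1 / 100))"] e \<open>\<delta> > 0\<close> by auto
    moreover have "ball a r \<subseteq> ball a e" using r by auto
    ultimately show ?thesis using e by (intro exI[of _ r]) auto
  qed
  then obtain \<rho> where \<rho>: "\<And>a. a \<in> A \<Longrightarrow> 0 < \<rho> a \<and> \<rho> a \<le> \<delta> / 10 \<and> \<rho> a \<le> 1 / 100 \<and> ball a (\<rho> a) \<subseteq> U \<and>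
      ennreal (\<eta> * psi (\<rho> a)) \<le> emeasure M (ball a (\<rho> a))"
    by metis
  have "A \<subseteq> (\<Union>a\<in>A. ball a (\<rho> a))" using \<rho> by force
  then obtain C where C: "countable C" "C \<subseteq> A"
     "pairwise (\<lambda>i j. disjnt (ball i (\<rho> i)) (ball j (\<rho> j))) C"
     "A \<subseteq> (\<Union>i\<in>C. ball i (5 * \<rho> i))"
    by (rule Vitali_covering_lemma_balls[of A "\<lambda>a. a" \<rho> A "\<delta> / 10"]) (use \<rho> in auto)
  \<comment> \<open>Enumerate the countable family by all of the natural numbers, with empty sets at unused indices.\<close>
  define used where "used = to_nat_on C ` C"
  define b where "b = from_nat_into C"
  have b: "b n \<in> C" "to_nat_on C (b n) = n" if "n \<in> used" for n
    using that C(1) by (auto simp: used_def b_def)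
  define D where "D n = (if n \<in> used then ball (b n) (5 * \<rho> (b n)) else {})" for n
  define B where "B n = (if n \<in> used then ball (b n) (\<rho> (b n)) else {})" for n
  have "A \<subseteq> (\<Union>n. D n)"
  proof
    fix x assume "x \<in> A"
    then obtain i where i: "i \<in> C" "x \<in> ball i (5 * \<rho> i)" using C(4) by blast
    then have "x \<in> D (to_nat_on C i)" using C(1) by (simp add: D_def used_def b_def)
    then show "x \<in> (\<Union>n. D n)" by blast
  qed
  moreover have diam: "diameter (D n) = (if n \<in> used then 10 * \<rho> (b n) else 0)" for n
    using \<rho>[of "b n"] b(1)[of n] C(2) by (auto simp: D_def diameter_ball)
  moreover have "diameter (D n) \<le> \<delta>" for n
    using \<rho>[of "b n"] b(1)[of n] C(2) \<open>\<delta> > 0\<close> by (auto simp: diam)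
  ultimately have "hausdorff_content psi \<delta> A \<le> (\<Sum>n. ennreal (psi (diameter (D n))))"
    unfolding hausdorff_content_def by (intro INF_lower) (auto simp: D_def)
  also have "\<dots> \<le> (\<Sum>n. ennreal (40 / \<eta>) * emeasure M (B n))"
  proof (intro suminf_le)
    fix n
    show "ennreal (psi (diameter (D n))) \<le> ennreal (40 / \<eta>) * emeasure M (B n)"
    proof (cases "n \<in> used")
      case True
      then have \<rho>n: "0 < \<rho> (b n)" "\<rho> (b n) \<le> 1 / 100"
        "ennreal (\<eta> * psi (\<rho> (b n))) \<le> emeasure M (ball (b n) (\<rho> (b n)))"
        using \<rho>[of "b n"] b(1)[of n] C(2) by auto
      have "ennreal (psi (diameter (D n))) \<le> ennreal (40 / \<eta> * (\<eta> * psi (\<rho> (b n))))"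
        using True \<rho>n psi_10_le \<open>\<eta> > 0\<close> by (auto simp: diam intro!: ennreal_leI)
      also have "\<dots> = ennreal (40 / \<eta>) * ennreal (\<eta> * psi (\<rho> (b n)))"
        using \<open>\<eta> > 0\<close> psi_nonneg by (intro ennreal_mult) auto
      also have "\<dots> \<le> ennreal (40 / \<eta>) * emeasure M (B n)"
        using True \<rho>n by (intro mult_left_mono) (auto simp: B_def)
      finally show ?thesis .
    qed (simp add: diam psi_def)
  qed auto
  also have "\<dots> = ennreal (40 / \<eta>) * (\<Sum>n. emeasure M (B n))"
    by simp
  also have "(\<Sum>n. emeasure M (B n)) = emeasure M (\<Union>n. B n)"
  proof (rule suminf_emeasure)
    show "range B \<subseteq> sets M" by (auto simp: M B_def)
    show "disjoint_family B"
      unfolding disjoint_family_on_def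
    proof (intro ballI impI)
      fix m n :: nat assume "m \<noteq> n"
      show "B m \<inter> B n = {}"
      proof (cases "m \<in> used \<and> n \<in> used")
        case True
        then have "b m \<noteq> b n" using b \<open>m \<noteq> n\<close> by metis
        then show ?thesis using True b(1) C(3) by (auto simp: B_def pairwise_def disjnt_def)
      qed (auto simp: B_def)
    qed
  qed
  also have "ennreal (40 / \<eta>) * emeasure M (\<Union>n. B n) \<le> ennreal (40 / \<eta>) * emeasure M U"
    using U \<rho> b(1) C(2) by (intro mult_left_mono emeasure_mono) (auto simp: B_def M split: if_splits)
  finally show ?thesis .
qed

text \<open>
  One index \<open>N\<close> serves both as the bound for the density and as the scale below which it holds, so
  that these sets increase to the set of points of finite upper density.
\<close>
definition psi_bounded_set :: "'a::metric_space measure \<Rightarrow> nat \<Rightarrow> 'a set" where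
  "psi_bounded_set M N =
     {a. \<forall>r. 0 < r \<longrightarrow> r < 1 / real (Suc N) \<longrightarrow> emeasure M (ball a r) \<le> ennreal (real N * psi r)}"

text \<open>
  A point outside all the sets \<open>psi_bounded_set M N\<close> has infinite upper density, so the covering
  estimate applies with every \<open>\<eta>\<close>.
\<close>
lemma hausdorff_measure_psi_unbounded_eq_0:
  fixes M :: "'a::euclidean_space measure"
  assumes M: "sets M = sets borel" and fin: "finite_measure M"
  shows "hausdorff_measure psi (- (\<Union>N. psi_bounded_set M N)) = 0"
  unfolding hausdorff_measure_eq_0_iff
proof (intro allI impI)
  let ?A = "- (\<Union>N. psi_bounded_set M N)"
  interpret finite_measure M by fact
  fix \<delta> :: real assume "\<delta> > 0"
  have "hausdorff_content psi \<delta> ?A \<le> 0"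
  proof (rule ennreal_le_epsilon)
    fix e :: real assume "e > 0"
    define c where "c = measure M UNIV"
    have "c \<ge> 0" by (simp add: c_def)
    define \<eta> where "\<eta> = 40 * (c + 1) / e"
    have "\<eta> > 0" using \<open>e > 0\<close> \<open>c \<ge> 0\<close> by (simp add: \<eta>_def)
    have "hausdorff_content psi \<delta> ?A \<le> ennreal (40 / \<eta>) * emeasure M UNIV"
    proof (rule hausdorff_content_psi_le_of_dense_balls[OF M])
      fix a and \<epsilon> :: real assume a: "a \<in> ?A" and "\<epsilon> > 0"
      obtain N where N: "\<eta> + 1 / \<epsilon> \<le> real N" using real_arch_simple by blast
      have "1 / \<epsilon> > 0" using \<open>\<epsilon> > 0\<close> by simp
      with N \<open>\<eta> > 0\<close> have N': "\<eta> \<le> real N" "1 / \<epsilon> < real (Suc N)" by linarith+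
      obtain r where r: "0 < r" "r < 1 / real (Suc N)" "ennreal (real N * psi r) < emeasure M (ball a r)"
        using a by (auto simp: psi_bounded_set_def not_le)
      have "1 / real (Suc N) < \<epsilon>" using N'(2) \<open>\<epsilon> > 0\<close> by (simp add: field_simps)
      moreover have "ennreal (\<eta> * psi r) \<le> ennreal (real N * psi r)"
        using N' psi_nonneg by (intro ennreal_leI mult_right_mono) auto
      ultimately show "\<exists>r. 0 < r \<and> r < \<epsilon> \<and> ennreal (\<eta> * psi r) \<le> emeasure M (ball a r)"
        using r by (intro exI[of _ r]) auto
    qed (use \<open>\<eta> > 0\<close> \<open>\<delta> > 0\<close> in auto)
    also have "\<dots> = ennreal (40 / \<eta> * c)"
      using \<open>\<eta> > 0\<close> \<open>c \<ge> 0\<close> by (simp only: emeasure_eq_measure c_def[symmetric]) (simp add: ennreal_mult[symmetric])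
    also have "\<dots> \<le> ennreal e"
      using \<open>e > 0\<close> \<open>c \<ge> 0\<close> by (intro ennreal_leI) (simp add: \<eta>_def field_simps)
    finally show "hausdorff_content psi \<delta> ?A \<le> 0 + ennreal e" by simp
  qed
  then show "hausdorff_content psi \<delta> ?A = 0" by simp
qed

text \<open>
  The density theorem for the gauge: a measure that does not charge \<open>F\<close> has density 0 at almost
  every point of \<open>F\<close>. By outer regularity the points with density above a fixed \<open>\<eta>\<close> lie in open
  sets of arbitrarily small mass, and the covering estimate is applied inside these.
\<close>
lemma hausdorff_measure_psi_dense_null_set_eq_0:
  fixes M :: "'a::euclidean_space measure"
  assumes M: "sets M = sets borel" and fin: "finite_measure M"
    and F: "F \<in> sets borel" "emeasure M F = 0"
  shows "hausdorff_measure psi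
    {a \<in> F. \<not> (\<forall>\<eta>>0. \<exists>\<rho>>0. \<forall>r. 0 < r \<longrightarrow> r < \<rho> \<longrightarrow> emeasure M (ball a r) \<le> ennreal (\<eta> * psi r))} = 0"
proof -
  define A where "A n = {a \<in> F. \<forall>\<epsilon>>0. \<exists>r. 0 < r \<and> r < \<epsilon> \<and>
      ennreal (1 / real (Suc n) * psi r) \<le> emeasure M (ball a r)}" for n
  have "hausdorff_measure psi (A n) = 0" for n
    unfolding hausdorff_measure_eq_0_iff
  proof (intro allI impI)
    fix \<delta> :: real assume "\<delta> > 0"
    have "hausdorff_content psi \<delta> (A n) \<le> 0"
    proof (rule ennreal_le_epsilon)
      fix e :: real assume "e > 0"
      have "(INF U\<in>{U. F \<subseteq> U \<and> open U}. emeasure M U) < ennreal (e / (40 * real (Suc n)))"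
        using outer_regular[OF M _ F(1)] F(2) finite_measure.emeasure_finite[OF fin] \<open>e > 0\<close>
        by simp
      then obtain U where U: "F \<subseteq> U" "open U" "emeasure M U < ennreal (e / (40 * real (Suc n)))"
        unfolding INF_less_iff by blast
      have "hausdorff_content psi \<delta> (A n) \<le> ennreal (40 / (1 / real (Suc n))) * emeasure M U"
        by (rule hausdorff_content_psi_le_of_dense_balls[OF M U(2)])
          (use U(1) \<open>\<delta> > 0\<close> in \<open>auto simp: A_def\<close>)
      also have "\<dots> \<le> ennreal (40 / (1 / real (Suc n))) * ennreal (e / (40 * real (Suc n)))"
        using U by (intro mult_left_mono) auto
      also have "\<dots> = ennreal e"
        using \<open>e > 0\<close> by (subst ennreal_mult[symmetric]) (auto simp: field_simps)
      finally show "hausdorff_content psi \<delta> (A n) \<le> 0 + ennreal e" by simp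
    qed
    then show "hausdorff_content psi \<delta> (A n) = 0" by simp
  qed
  then have null: "hausdorff_measure psi (\<Union>n. A n) = 0" by (rule hausdorff_measure_0_UN)
  show ?thesis
  proof (rule hausdorff_measure_0_mono[OF null], rule subsetI)
    fix a assume "a \<in> {a \<in> F. \<not> (\<forall>\<eta>>0. \<exists>\<rho>>0. \<forall>r. 0 < r \<longrightarrow> r < \<rho> \<longrightarrow>
        emeasure M (ball a r) \<le> ennreal (\<eta> * psi r))}"
    then obtain \<eta> where a: "a \<in> F" and \<eta>: "\<eta> > 0"
      "\<And>\<rho>. \<rho> > 0 \<Longrightarrow> \<exists>r. 0 < r \<and> r < \<rho> \<and> ennreal (\<eta> * psi r) < emeasure M (ball a r)"
      by (auto simp: not_le)
    obtain n where n: "1 / real (Suc n) < \<eta>" using \<eta>(1) nat_approx_posE by blast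
    have "\<exists>r. 0 < r \<and> r < \<epsilon> \<and> ennreal (1 / real (Suc n) * psi r) \<le> emeasure M (ball a r)" if e: "\<epsilon> > 0" for \<epsilon>
    proof -
      obtain r where r: "0 < r" "r < \<epsilon>" "ennreal (\<eta> * psi r) < emeasure M (ball a r)" using \<eta>(2)[OF e] by blast
      have "ennreal (1 / real (Suc n) * psi r) \<le> ennreal (\<eta> * psi r)"
        using n psi_nonneg by (intro ennreal_leI mult_right_mono) auto
      then show ?thesis using r by (intro exI[of _ r]) auto
    qed
    then show "a \<in> (\<Union>n. A n)" using a unfolding A_def by blast
  qed
qed

text \<open>
  The mass of the open ball \<open>B(a, r)\<close> is lower semicontinuous in \<open>a\<close>, since it is approximated from
  inside by the balls \<open>B(a, s)\<close> with \<open>s < r\<close>.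
  In particular the sets are Borel.
\<close>
lemma closed_psi_bounded_set:
  fixes M :: "'a::metric_space measure"
  assumes M: "sets M = sets borel"
  shows "closed (psi_bounded_set M N)"
proof -
  have op: "open {a. c < emeasure M (ball a r)}" for c r
    unfolding open_dist
  proof (intro ballI)
    fix a assume a: "a \<in> {a. c < emeasure M (ball a r)}"
    have "(SUP n. emeasure M (ball a (r - 1 / real (Suc n)))) = emeasure M (\<Union>n. ball a (r - 1 / real (Suc n)))"
    proof (intro SUP_emeasure_incseq)
      have "1 / real (Suc n) \<le> 1 / real (Suc m)" if "m \<le> n" for m n
        using that by (intro divide_left_mono) auto
      then show "incseq (\<lambda>n. ball a (r - 1 / real (Suc n)))"
        unfolding incseq_def by (intro allI impI subset_ball diff_left_mono)
    qed (auto simp: M)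
    also have "(\<Union>n. ball a (r - 1 / real (Suc n))) = ball a r"
    proof (intro antisym subsetI)
      fix x assume "x \<in> ball a r"
      then obtain n where "1 / real (Suc n) < r - dist a x" using nat_approx_posE[of "r - dist a x"] by auto
      then have "x \<in> ball a (r - 1 / real (Suc n))" by simp
      then show "x \<in> (\<Union>n. ball a (r - 1 / real (Suc n)))" by blast
    qed (auto intro: less_trans less_le_trans)
    finally obtain n where n: "c < emeasure M (ball a (r - 1 / real (Suc n)))"
      using a less_SUP_iff[of c "\<lambda>n. emeasure M (ball a (r - 1 / real (Suc n)))" UNIV] by auto
    have "c < emeasure M (ball b r)" if "dist b a < 1 / real (Suc n)" for b
    proof (rule less_le_trans[OF n emeasure_mono])
      show "ball a (r - 1 / real (Suc n)) \<subseteq> ball b r"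
      proof
        fix x assume "x \<in> ball a (r - 1 / real (Suc n))"
        then show "x \<in> ball b r" using dist_triangle[of b x a] that by simp
      qed
    qed (simp add: M)
    then show "\<exists>e>0. \<forall>b. dist b a < e \<longrightarrow> b \<in> {a. c < emeasure M (ball a r)}"
      by (intro exI[of _ "1 / real (Suc n)"]) auto
  qed
  have "- psi_bounded_set M N =
      (\<Union>r\<in>{r. 0 < r \<and> r < 1 / real (Suc N)}. {a. ennreal (real N * psi r) < emeasure M (ball a r)})"
    by (auto simp: psi_bounded_set_def not_le)
  then show ?thesis unfolding closed_def using op by auto
qed

section \<open>Capacities\<close>

text \<open>
  A point at distance \<open>d\<close> lies in all balls \<open>B(z, s / 2 ^ k)\<close> with \<open>k < ln (s / d)\<close>. Summing the
  indicators replaces integrals of the logarithmic kernel by sums of masses of balls.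
\<close>
lemma ln_le_sum_indicator_ball:
  fixes z w :: "'a::metric_space"
  assumes "s > 0"
  shows "ennreal (ln (s / dist z w)) \<le> (\<Sum>k. indicator (ball z (s / 2 ^ k)) w)"
proof (cases "ln (s / dist z w) \<le> 0")
  case False
  then have d: "dist z w > 0" by (cases "z = w") auto
  define n where "n = nat \<lceil>ln (s / dist z w)\<rceil>"
  have "w \<in> ball z (s / 2 ^ k)" if "k < n" for k
  proof -
    have "real k < ln (s / dist z w)" using that False unfolding n_def by linarith
    then have "exp (real k) < s / dist z w" 
      using d \<open>s > 0\<close> by (metis exp_ln exp_less_mono divide_pos_pos)
    moreover have "(2::real) ^ k \<le> exp (real k)"
      using power_mono[of 2 "exp 1 :: real" k] exp_ge_add_one_self[of 1] by (simp add: exp_of_nat_mult[symmetric])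
    ultimately have "2 ^ k < s / dist z w" by linarith
    then show ?thesis using d by (simp add: field_simps)
  qed
  then have "(\<Sum>k<n. indicator (ball z (s / 2 ^ k)) w) = (\<Sum>k<n. 1::ennreal)"
    by (intro sum.cong) auto
  then have "ennreal (real n) = (\<Sum>k<n. indicator (ball z (s / 2 ^ k)) w)"
    by (simp add: ennreal_of_nat_eq_real_of_nat)
  also have "\<dots> \<le> (\<Sum>k. indicator (ball z (s / 2 ^ k)) w)" by (intro sum_le_suminf) auto
  finally have "ennreal (real n) \<le> (\<Sum>k. indicator (ball z (s / 2 ^ k)) w)" .
  moreover have "ln (s / dist z w) \<le> real n" unfolding n_def by linarith
  ultimately show ?thesis using ennreal_leI order_trans by blast
qed (simp add: ennreal_neg)

lemma e2ennreal_log_kernel_le_sum_indicator_ball: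
  assumes "s > 0"
  shows "e2ennreal (log_kernel z w) \<le>
    ennreal (ln (1 / s)) + (\<Sum>k. indicator (ball z (s / 2 ^ k)) w)"
proof (cases "w = z")
  case True
  have "of_nat n \<le> (\<Sum>k. indicator (ball z (s / 2 ^ k)) w :: ennreal)" for n
  proof -
    have "of_nat n = (\<Sum>k<n. indicator (ball z (s / 2 ^ k)) w :: ennreal)"
      using assms True by simp
    also have "\<dots> \<le> (\<Sum>k. indicator (ball z (s / 2 ^ k)) w)" by (intro sum_le_suminf) auto
    finally show ?thesis .
  qed
  then have "(SUP n. of_nat n) \<le> (\<Sum>k. indicator (ball z (s / 2 ^ k)) w :: ennreal)"
    by (rule SUP_least)
  then show ?thesis by (simp add: ennreal_SUP_of_nat_eq_top top_unique)
next
  case False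
  then have "ln (1 / cmod (z - w)) = ln (1 / s) + ln (s / dist z w)"
    using assms by (simp add: ln_div dist_norm)
  then have "e2ennreal (log_kernel z w) = ennreal (ln (1 / s) + ln (s / dist z w))"
    using False by (simp add: log_kernel_def)
  also have "\<dots> \<le> ennreal (ln (1 / s)) + ennreal (ln (s / dist z w))"
    by (cases "ln (1 / s) \<ge> 0"; cases "ln (s / dist z w) \<ge> 0")
      (auto simp: ennreal_neg ennreal_plus[symmetric] simp del: ennreal_plus intro!: ennreal_leI)
  also have "\<dots> \<le> ennreal (ln (1 / s)) + (\<Sum>k. indicator (ball z (s / 2 ^ k)) w)"
    by (intro add_left_mono ln_le_sum_indicator_ball assms)
  finally show ?thesis .
qed

lemma nn_integral_sum_indicator_ball:
  assumes "sets M = sets borel"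
  shows "(\<integral>\<^sup>+w. (\<Sum>k. indicator (ball z (s / 2 ^ k)) w) \<partial>M) = (\<Sum>k. emeasure M (ball z (s / 2 ^ k)))"
proof -
  have [measurable]: "ball z r \<in> sets M" for r using assms by auto
  have "indicator (ball z r) \<in> borel_measurable M" for r by (intro borel_measurable_indicator) simp
  then show ?thesis by (simp add: nn_integral_suminf)
qed

lemma suminf_ennreal_half: "c \<ge> 0 \<Longrightarrow> (\<Sum>k. ennreal (c * (1 / 2) ^ k)) = ennreal (2 * c)"
  using sums_mult[OF geometric_sums[of "1 / 2 :: real"], of c]
  by (intro suminf_ennreal_eq) (auto simp: mult.commute)

lemma log_kernel_borel_measurable [measurable]:
  "(\<lambda>(z, w). log_kernel z w) \<in> borel_measurable (borel \<Otimes>\<^sub>M borel)"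
  unfolding log_kernel_def by measurable

lemma log_kernel_borel_measurable2 [measurable (raw)]:
  assumes "f \<in> borel_measurable M" "g \<in> borel_measurable M"
  shows "(\<lambda>x. log_kernel (f x) (g x)) \<in> borel_measurable M"
  using measurable_compose[OF measurable_Pair[OF assms] log_kernel_borel_measurable] by simp

lemma not_compact_ball:
  fixes a :: "'a::euclidean_space"
  assumes "r > 0"
  shows "\<not> compact (ball a r)"
proof
  assume "compact (ball a r)"
  then have "ball a r = {} \<or> ball a r = UNIV" using clopen[of "ball a r"] compact_imp_closed by blast
  then show False using assms bounded_ball[of a r] not_bounded_UNIV by auto
qed

lemma capacity_le_ball:
  assumes "r > 0" "S \<subseteq> ball a r"
  shows "capacity S \<le> capacity (ball a r)"
  unfolding capacity_def using not_compact_ball[OF assms(1)] assms(2)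
  by (auto intro!: SUP_upper SUP_subset_mono)

text \<open>
  The case distinction in the definition of \<^const>\<open>capacity\<close> disappears in upper bounds: it is
  enough to treat the compact subsets of the set.
\<close>
lemma mult_capacity_le:
  assumes "\<And>K. compact K \<Longrightarrow> K \<subseteq> S \<Longrightarrow> c * compact_capacity K \<le> b"
  shows "c * capacity S \<le> b"
  using assms by (auto simp: capacity_def SUP_mult_left_ennreal intro!: SUP_least)

text \<open>
  The test measure is Lebesgue measure on the concentric closed disc of radius \<open>s = r / 2\<close>,
  divided by its area times \<open>ln (1 / s) + 2\<close>. The kernel is at most \<open>ln (1 / s)\<close> plus the number of
  layers \<open>B(z, s / 2 ^ k)\<close> that contain \<open>w\<close>, and the masses of the layers sum to at most twice the total.
\<close>
lemma capacity_ball_ge: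
  fixes a :: complex
  assumes "0 < r" "r \<le> exp (- 1)"
  shows "ennreal (1 / (4 * ln (1 / r))) \<le> capacity (ball a r)"
proof -
  define s where "s = r / 2"
  define V where "V = pi * s\<^sup>2"
  define L where "L = ln (1 / s) + 2"
  have "ln r \<le> - 1" using assms ln_mono[of r "exp (-1)"] by simp
  moreover have "ln (2::real) \<le> 1" using ln_2_less_1 by simp
  moreover have "ln (2::real) > 0" by simp
  moreover have "ln (1 / s) = ln 2 - ln r" using assms by (simp add: s_def ln_div)
  moreover have "ln (1 / r) = - ln r" using assms by (simp add: ln_div)
  ultimately have L: "ln (1 / s) > 0" "L > 0" "L \<le> 4 * ln (1 / r)" "ln (1 / r) > 0"
    unfolding L_def by linarith+
  have s: "s > 0" "s < r" and V: "V > 0" using assms by (auto simp: s_def V_def)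
  define \<nu> where "\<nu> = density lborel (\<lambda>w. ennreal (1 / (V * L)) * indicator (cball a s) w)"
  have sets [measurable_cong, simp]: "sets \<nu> = sets borel" by (simp add: \<nu>_def)
  have em: "emeasure \<nu> X = ennreal (1 / (V * L)) * emeasure lborel (cball a s \<inter> X)" if "X \<in> sets borel" for X
  proof -
    have [measurable]: "cball a s \<in> sets borel" "X \<in> sets borel" using that by auto
    have "emeasure \<nu> X = (\<integral>\<^sup>+w. ennreal (1 / (V * L)) * indicator (cball a s \<inter> X) w \<partial>lborel)"
      unfolding \<nu>_def using that
      by (subst emeasure_density) (auto simp: indicator_inter_arith mult.assoc)
    then show ?thesis by (simp add: nn_integral_cmult)
  qed
  have cb: "emeasure lborel (cball a s) = ennreal V"
    using s by (simp add: emeasure_cball V_def unit_ball_vol_2)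
  have mass: "emeasure \<nu> X = ennreal (1 / L)" if "X \<in> sets borel" "cball a s \<subseteq> X" for X
    using that V L by (simp add: em Int_absorb2 cb ennreal_mult[symmetric])
  have "finite_measure \<nu>"
    by standard (use sets_eq_imp_space_eq[OF sets] in \<open>simp add: mass\<close>)
  have pot: "ext_log_potential \<nu> z \<le> 1" for z
  proof -
    have "(\<integral>\<^sup>+ w. e2ennreal (log_kernel z w) \<partial>\<nu>) \<le>
        (\<integral>\<^sup>+ w. ennreal (ln (1 / s)) + (\<Sum>k. indicator (ball z (s / 2 ^ k)) w) \<partial>\<nu>)"
      by (intro nn_integral_mono e2ennreal_log_kernel_le_sum_indicator_ball s)
    also have "\<dots> = ennreal (ln (1 / s)) * emeasure \<nu> UNIV + (\<Sum>k. emeasure \<nu> (ball z (s / 2 ^ k)))"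
      using sets_eq_imp_space_eq[OF sets] by (subst nn_integral_add) (auto simp: nn_integral_sum_indicator_ball intro!: borel_measurable_suminf_order borel_measurable_indicator)
    also have "\<dots> \<le> ennreal (ln (1 / s)) * ennreal (1 / L) + (\<Sum>k. ennreal (1 / L * (1 / 2) ^ k))"
    proof (intro add_mono mult_left_mono suminf_le)
      fix k
      have "emeasure \<nu> (ball z (s / 2 ^ k)) \<le> ennreal (1 / (V * L)) * emeasure lborel (ball z (s / 2 ^ k))"
        by (simp add: em) (intro mult_left_mono emeasure_mono, auto)
      also have "emeasure lborel (ball z (s / 2 ^ k)) = ennreal (V * (1 / 4) ^ k)"
        using s by (simp add: emeasure_ball V_def unit_ball_vol_2 power_divide power_mult[symmetric] power2_eq_square power_mult_distrib[symmetric])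
      also have "ennreal (1 / (V * L)) * \<dots> = ennreal (1 / L * (1 / 4) ^ k)"
        using V L by (subst ennreal_mult[symmetric]) auto
      also have "\<dots> \<le> ennreal (1 / L * (1 / 2) ^ k)"
        using L by (intro ennreal_leI mult_left_mono power_mono) auto
      finally show "emeasure \<nu> (ball z (s / 2 ^ k)) \<le> ennreal (1 / L * (1 / 2) ^ k)" .
    qed (auto simp: mass)
    also have "\<dots> = ennreal (ln (1 / s) * (1 / L) + 2 * (1 / L))"
      using L by (subst suminf_ennreal_half) (auto simp: ennreal_mult[symmetric] ennreal_plus[symmetric] simp del: ennreal_plus)
    also have "ln (1 / s) * (1 / L) + 2 * (1 / L) = L / L"
      unfolding L_def by (simp only: add_divide_distrib times_divide_eq_right mult_1_right)
    also have "L / L = 1" using L by simp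
    finally have le: "(\<integral>\<^sup>+ w. e2ennreal (log_kernel z w) \<partial>\<nu>) \<le> 1" by simp
    then have "enn2ereal (\<integral>\<^sup>+ w. e2ennreal (log_kernel z w) \<partial>\<nu>) \<le> 1"
      by (simp add: less_eq_ennreal.rep_eq one_ennreal.rep_eq)
    moreover have "0 \<le> enn2ereal (\<integral>\<^sup>+ w. e2ennreal (- log_kernel z w) \<partial>\<nu>)" by simp
    ultimately show ?thesis unfolding ext_log_potential_def by (metis ereal_diff_le_self order_trans)
  qed
  have "emeasure \<nu> (UNIV - cball a s) = 0" by (simp add: em)
  then have "emeasure \<nu> (cball a s) \<le> compact_capacity (cball a s)"
    unfolding compact_capacity_def using \<open>finite_measure \<nu>\<close> pot by (intro SUP_upper) auto
  also have "\<dots> \<le> capacity (ball a r)"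
    using s not_compact_ball[OF assms(1)] by (auto simp: capacity_def intro!: SUP_upper)
  finally have "ennreal (1 / L) \<le> capacity (ball a r)" by (simp add: mass)
  moreover have "ennreal (1 / (4 * ln (1 / r))) \<le> ennreal (1 / L)"
    using L by (intro ennreal_leI divide_left_mono) auto
  ultimately show ?thesis by order
qed

text \<open>
  The weak type inequality for capacity. Integrate the potential of \<open>M\<close> against an admissible measure
  \<open>\<nu>\<close> on \<open>K\<close> and exchange the integrals: the potential of \<open>\<nu>\<close> is at most 1. The proximity hypothesis
  makes the kernel nonnegative on the relevant pairs, so that the integral of its positive part is all
  of the potential.
\<close>
lemma mult_compact_capacity_le_of_potential_ge:
  assumes M: "sets M = sets borel" "finite_measure M"
    and K: "compact K"
    and near: "AE w in M. \<forall>x\<in>K. dist w x \<le> 1"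
    and ge: "\<And>x. x \<in> K \<Longrightarrow> ennreal t \<le> (\<integral>\<^sup>+w. e2ennreal (log_kernel w x) \<partial>M)"
  shows "ennreal t * compact_capacity K \<le> emeasure M UNIV"
proof -
  have "ennreal t * emeasure \<nu> K \<le> emeasure M UNIV"
    if \<nu>: "sets \<nu> = sets borel" "finite_measure \<nu>" "emeasure \<nu> (UNIV - K) = 0"
      "\<And>z. ext_log_potential \<nu> z \<le> 1" for \<nu>
  proof -
    note [measurable_cong] = M(1) \<nu>(1)
    have Kb [measurable]: "K \<in> sets borel" using K by (simp add: compact_imp_closed)
    interpret M: finite_measure M by fact
    interpret \<nu>: finite_measure \<nu> by fact
    interpret pair_sigma_finite M \<nu> ..
    have spaces: "space M = UNIV" "space \<nu> = UNIV"
      using sets_eq_imp_space_eq[OF M(1)] sets_eq_imp_space_eq[OF \<nu>(1)] by auto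
    have inK: "AE x in \<nu>. x \<in> K"
      using \<nu>(3) by (intro AE_I[where N = "UNIV - K"]) (auto simp: \<nu>(1))
    have one: "(\<integral>\<^sup>+x. e2ennreal (log_kernel w x) \<partial>\<nu>) \<le> 1" if w: "\<forall>x\<in>K. dist w x \<le> 1" for w
    proof -
      have "AE x in \<nu>. e2ennreal (- log_kernel w x) = 0"
        using inK
      proof eventually_elim
        case (elim x)
        have "0 \<le> log_kernel w x"
        proof (cases "x = w")
          case False
          then show ?thesis using elim w by (auto simp: log_kernel_def dist_norm intro!: ln_ge_zero)
        qed (simp add: log_kernel_def)
        then show ?case by (simp add: e2ennreal_neg)
      qed
      then have "(\<integral>\<^sup>+ x. e2ennreal (- log_kernel w x) \<partial>\<nu>) = 0"
        by (subst nn_integral_0_iff_AE) auto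
      then have "enn2ereal (\<integral>\<^sup>+x. e2ennreal (log_kernel w x) \<partial>\<nu>) \<le> 1"
        using \<nu>(4)[of w] by (simp add: ext_log_potential_def zero_ennreal.rep_eq)
      then show ?thesis by (simp add: less_eq_ennreal.rep_eq one_ennreal.rep_eq)
    qed
    have "ennreal t * emeasure \<nu> K = (\<integral>\<^sup>+x. ennreal t * indicator K x \<partial>\<nu>)"
      by (simp add: nn_integral_cmult)
    also have "\<dots> \<le> (\<integral>\<^sup>+x. \<integral>\<^sup>+w. e2ennreal (log_kernel w x) \<partial>M \<partial>\<nu>)"
      using ge by (intro nn_integral_mono) (auto split: split_indicator)
    also have "\<dots> = (\<integral>\<^sup>+w. \<integral>\<^sup>+x. e2ennreal (log_kernel w x) \<partial>\<nu> \<partial>M)"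
      using Fubini'[of "\<lambda>w x. e2ennreal (log_kernel w x)"] by simp
    also have "\<dots> \<le> (\<integral>\<^sup>+w. 1 \<partial>M)"
      using near by (intro nn_integral_mono_AE) (auto intro: one elim!: eventually_mono)
    finally show ?thesis by (simp add: spaces)
  qed
  then show ?thesis
    unfolding compact_capacity_def SUP_mult_left_ennreal by (intro SUP_least) auto
qed

section \<open>First order expansion of the logarithmic kernel\<close>

definition log_expansion_remainder :: "'a::real_inner \<Rightarrow> 'a \<Rightarrow> real" where
  "log_expansion_remainder y v =
     ln (1 / norm (y - v)) - ln (1 / norm v) - inner y v / (norm v)\<^sup>2"

text \<open>
  With \<open>q = norm y / norm v\<close> and \<open>1 + s = (norm (y - v) / norm v)\<^sup>2\<close>, the remainder is
  \<open>(s - ln (1 + s)) / 2 - q\<^sup>2 / 2\<close>. Since \<open>1 + s \<ge> 1 / 4\<close>, the first term is of order \<open>s\<^sup>2\<close>, hence of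
  order \<open>q\<^sup>2\<close>.
\<close>
lemma log_expansion_remainder_far:
  fixes y v :: "'a::real_inner"
  assumes "v \<noteq> 0" "2 * norm y \<le> norm v"
  shows "\<bar>log_expansion_remainder y v\<bar> \<le> 13 * (norm y / norm v)\<^sup>2"
proof -
  define q where "q = norm y / norm v"
  define i where "i = inner y v / (norm v)\<^sup>2"
  define s where "s = q\<^sup>2 - 2 * i"
  have v: "norm v > 0" using assms by simp
  have q: "0 \<le> q" "q \<le> 1 / 2" using assms v by (auto simp: q_def field_simps)
  have "\<bar>inner y v\<bar> \<le> norm y * norm v" by (rule Cauchy_Schwarz_ineq2)
  then have "\<bar>i\<bar> \<le> norm y * norm v / (norm v)\<^sup>2"
    unfolding i_def abs_divide abs_power2 by (rule divide_right_mono) simp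
  then have i: "\<bar>i\<bar> \<le> q" using v by (simp add: q_def power2_eq_square)
  have "(norm (y - v))\<^sup>2 = (norm y)\<^sup>2 - 2 * inner y v + (norm v)\<^sup>2"
    by (simp add: power2_norm_eq_inner inner_diff_left inner_diff_right inner_commute)
  also have "\<dots> = (norm v)\<^sup>2 * (1 + s)"
    using v by (simp add: s_def q_def i_def power_divide field_simps)
  finally have sq: "(norm (y - v))\<^sup>2 = (norm v)\<^sup>2 * (1 + s)" .
  have "norm (y - v) \<ge> norm v / 2" using assms norm_triangle_ineq2[of v y] by (simp add: norm_minus_commute)
  then have pos: "norm (y - v) > 0" "(norm (y - v))\<^sup>2 \<ge> (norm v / 2)\<^sup>2" using v by (auto intro: power_mono less_le_trans[of 0 "norm v / 2"])
  have "(norm v)\<^sup>2 * (1 / 4) \<le> (norm v)\<^sup>2 * (1 + s)" using pos(2) by (simp add: sq[symmetric] power_divide)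
  then have s: "1 + s \<ge> 1 / 4" using v by (subst (asm) mult_le_cancel_left_pos) auto
  have "2 * ln (norm (y - v)) = 2 * ln (norm v) + ln (1 + s)"
    using arg_cong[OF sq, of ln] pos v s
    by (simp add: ln_mult ln_realpow)
  then have eq: "log_expansion_remainder y v = (s - ln (1 + s)) / 2 - q\<^sup>2 / 2"
  proof -
    have "log_expansion_remainder y v = ln (norm v) - ln (norm (y - v)) - i"
      using pos v by (simp add: log_expansion_remainder_def ln_div i_def)
    moreover have "R = (x - l) / 2 - Q / 2"
      if "R = b - a - c" "2 * a = 2 * b + l" "x = Q - 2 * c" for R a b c l x Q :: real
      unfolding that(1,3) using that(2) by (simp add: field_simps)
    ultimately show ?thesis
      using \<open>2 * ln (norm (y - v)) = 2 * ln (norm v) + ln (1 + s)\<close> s_def by blast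
  qed
  have l1: "ln (1 + s) \<le> s" using ln_le_minus_one[of "1 + s"] s by simp
  have "- ln (1 + s) \<le> 1 / (1 + s) - 1"
    using ln_le_minus_one[of "1 / (1 + s)"] s by (simp add: ln_div)
  then have "s - ln (1 + s) \<le> s\<^sup>2 / (1 + s)" using s by (simp add: field_simps power2_eq_square)
  also have "\<dots> \<le> s\<^sup>2 / (1 / 4)" using s by (intro divide_left_mono) auto
  finally have l2: "s - ln (1 + s) \<le> 4 * s\<^sup>2" by simp
  have "q\<^sup>2 \<le> q / 2" using mult_left_mono[OF q(2,1)] by (simp add: power2_eq_square)
  then have "\<bar>s\<bar> \<le> 5 / 2 * q" using i zero_le_power2[of q] unfolding s_def by linarith
  then have "s\<^sup>2 \<le> (5 / 2 * q)\<^sup>2" using q by (simp add: abs_le_square_iff[symmetric])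
  then have s2: "s\<^sup>2 \<le> 25 / 4 * q\<^sup>2" by (simp add: power_mult_distrib power_divide)
  show ?thesis unfolding eq q_def[symmetric] diff_divide_distrib using l1 l2 s2 zero_le_power2[of q] by linarith
qed

text \<open>
  For \<open>norm v \<ge> 2 * norm y\<close> this is the second order Taylor estimate. For smaller \<open>v\<close> the linear term
  and the negative part of the logarithm are of size \<open>norm y / norm v\<close>, and what remains is the
  singularity at \<open>v = y\<close>.
\<close>
lemma log_expansion_remainder_bound:
  fixes y v :: "'a::real_inner"
  assumes "y \<noteq> 0" "v \<noteq> 0" "v \<noteq> y"
  shows "\<bar>log_expansion_remainder y v\<bar> \<le> 13 * (norm y / norm v) * min 1 (norm y / norm v) +
    (if norm v < 2 * norm y then max 0 (ln (2 * norm y / norm (y - v))) else 0)"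
    (is "_ \<le> _ + ?P")
proof (cases "2 * norm y \<le> norm v")
  case True
  then have "norm y \<le> norm v" using norm_ge_zero[of y] by linarith
  then have "norm y / norm v \<le> 1" using assms by simp
  then have "min 1 (norm y / norm v) = norm y / norm v" by simp
  moreover have "?P \<ge> 0" by simp
  ultimately show ?thesis using log_expansion_remainder_far[OF assms(2) True] by (simp add: power2_eq_square)
next
  case False
  define q where "q = norm y / norm v"
  have pos: "norm y > 0" "norm v > 0" "norm (y - v) > 0" using assms by auto
  have q: "q > 1 / 2" using False pos by (simp add: q_def field_simps)
  have "\<bar>inner y v\<bar> \<le> norm y * norm v" by (rule Cauchy_Schwarz_ineq2)
  then have "\<bar>inner y v / (norm v)\<^sup>2\<bar> \<le> norm y * norm v / (norm v)\<^sup>2"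
    unfolding abs_divide abs_power2 by (rule divide_right_mono) simp
  then have i: "\<bar>inner y v / (norm v)\<^sup>2\<bar> \<le> q" using pos by (simp add: q_def power2_eq_square)
  have "ln (norm v / norm (y - v)) \<le> ln (2 * norm y / norm (y - v))"
    using False pos by (intro ln_mono divide_right_mono) auto
  then have up: "ln (norm v / norm (y - v)) \<le> ?P" using False by auto
  have "norm (y - v) \<le> 3 * norm y" using False norm_triangle_ineq4[of y v] by linarith
  then have "norm (y - v) / norm v \<le> 3 * q" using pos by (simp add: q_def field_simps)
  moreover have "ln (norm (y - v) / norm v) \<le> norm (y - v) / norm v"
    using ln_le_minus_one[of "norm (y - v) / norm v"] pos by simp
  ultimately have lo: "- ln (norm v / norm (y - v)) \<le> 3 * q" using pos by (simp add: ln_div)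
  have "log_expansion_remainder y v = ln (norm v / norm (y - v)) - inner y v / (norm v)\<^sup>2"
    using pos by (simp add: log_expansion_remainder_def ln_div)
  moreover have "?P \<ge> 0" by simp
  ultimately have "\<bar>log_expansion_remainder y v\<bar> \<le> 4 * q + ?P" using up lo i q by linarith
  moreover have "4 * q \<le> 13 * q * min 1 q"
  proof -
    have "q * (1 / 2) \<le> q * min 1 q" using q by (intro mult_left_mono) auto
    then show ?thesis using q by linarith
  qed
  ultimately show ?thesis unfolding q_def by linarith
qed

section \<open>Integrals against measures with small balls\<close>

lemma inverse_dist_le_sum_indicator_ball:
  fixes a w :: "'a::metric_space"
  assumes "R > 0"
  shows "ennreal (1 / dist a w) * indicator (ball a R) w \<le>
    (\<Sum>k. ennreal (exp (real (Suc k)) / R) * indicator (ball a (R * exp (- real k))) w)"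
proof (cases "w \<in> ball a R \<and> w \<noteq> a")
  case True
  define d where "d = dist a w"
  have d: "0 < d" "d < R" using True by (auto simp: d_def)
  \<comment> \<open>The ceiling puts \<open>w\<close> strictly inside the open ball of the chosen layer.\<close>
  define k where "k = nat (\<lceil>ln (R / d)\<rceil> - 1)"
  have "ln (R / d) > 0" using d by simp
  then have "real k < ln (R / d)" "ln (R / d) \<le> real (Suc k)" unfolding k_def by linarith+
  then have "exp (real k) < R / d" "R / d \<le> exp (real (Suc k))"
    using d by (metis exp_ln exp_less_mono exp_le_cancel_iff divide_pos_pos less_trans)+
  then have "d < R * exp (- real k)" "1 / d \<le> exp (real (Suc k)) / R"
    using d by (auto simp: exp_minus field_simps)
  then have "ennreal (1 / dist a w) * indicator (ball a R) w \<le>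
      ennreal (exp (real (Suc k)) / R) * indicator (ball a (R * exp (- real k))) w"
    using True by (auto simp: d_def intro!: ennreal_leI)
  also have "\<dots> \<le> (\<Sum>k. ennreal (exp (real (Suc k)) / R) * indicator (ball a (R * exp (- real k))) w)"
    (is "?g k \<le> suminf ?g")
  proof -
    have "sum ?g {k} \<le> suminf ?g" by (intro sum_le_suminf) auto
    moreover have "sum f {k} = f k" for f :: "nat \<Rightarrow> ennreal" by simp
    ultimately show ?thesis by metis
  qed
  finally show ?thesis .
qed (auto simp: indicator_def)

lemma suminf_inverse_square_shift_le:
  fixes L :: real
  assumes "L \<ge> 2" "c \<ge> 0"
  shows "(\<Sum>k. ennreal (c / (L + real k)\<^sup>2)) \<le> ennreal (2 * c / L)"
proof -
  \<comment> \<open>A telescoping majorant; its first term is at most \<open>2 c / L\<close> because \<open>L \<ge> 2\<close>.\<close>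
  define f where "f k = c / (L - 1 + real k)" for k
  have "f \<longlonglongrightarrow> 0"
    unfolding f_def using filterlim_real_sequentially
    by (intro tendsto_divide_0[OF tendsto_const] filterlim_at_top_imp_at_infinity filterlim_tendsto_add_at_top[OF tendsto_const])
  from telescope_sums'[OF this] have "(\<lambda>k. f k - f (Suc k)) sums f 0" by simp
  moreover have le: "c / (L + real k)\<^sup>2 \<le> f k - f (Suc k)" for k
  proof -
    have "f k - f (Suc k) = c / ((L - 1 + real k) * (L + real k))"
      using assms by (simp add: f_def field_simps)
    moreover have "(L - 1 + real k) * (L + real k) \<le> (L + real k)\<^sup>2"
      using assms by (simp add: power2_eq_square mult_right_mono)
    ultimately show ?thesis using assms by (simp add: divide_left_mono)
  qed
  moreover have "f k - f (Suc k) \<ge> 0" for k using le[of k] assms by (meson order_trans divide_nonneg_nonneg zero_le_power2)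
  ultimately have "(\<Sum>k. ennreal (c / (L + real k)\<^sup>2)) \<le> ennreal (f 0)"
    by (subst suminf_ennreal_eq[symmetric, of "\<lambda>k. f k - f (Suc k)"]) (auto intro!: suminf_le ennreal_leI)
  also have "f 0 \<le> c / (L / 2)" unfolding f_def using assms by (intro divide_left_mono) auto
  finally show ?thesis by (simp add: ennreal_leI mult.commute)
qed

text \<open>
  The role of the gauge. On the layers \<open>B(a, R e\<^sup>-\<^sup>k)\<close> the integrand is about \<open>e\<^sup>k / R\<close>, so the integral
  is bounded by the sum of \<open>C / (ln (1 / R) + k)\<^sup>2\<close>, which has the order of \<open>C / ln (1 / R)\<close>: up to the
  constant, the capacity of a disc of radius \<open>R\<close>.
\<close>
lemma nn_integral_inverse_dist_le:
  fixes a :: "'a::metric_space"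
  assumes M: "sets M = sets borel" and R: "0 < R" "R \<le> exp (- 2)" and "C \<ge> 0"
    and dens: "\<And>r. 0 < r \<Longrightarrow> r \<le> R \<Longrightarrow> emeasure M (ball a r) \<le> ennreal (C * psi r)"
  shows "(\<integral>\<^sup>+w. ennreal (1 / dist a w) * indicator (ball a R) w \<partial>M) \<le> ennreal (6 * C / ln (1 / R))"
proof -
  define L where "L = ln (1 / R)"
  have L: "L \<ge> 2" using R ln_mono[of R "exp (-2)"] by (simp add: L_def ln_div)
  have [measurable]: "ball a r \<in> sets M" for r using M by auto
  have "(\<integral>\<^sup>+w. ennreal (1 / dist a w) * indicator (ball a R) w \<partial>M) \<le>
      (\<integral>\<^sup>+w. (\<Sum>k. ennreal (exp (real (Suc k)) / R) * indicator (ball a (R * exp (- real k))) w) \<partial>M)"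
    by (intro nn_integral_mono inverse_dist_le_sum_indicator_ball R)
  also have "\<dots> = (\<Sum>k. ennreal (exp (real (Suc k)) / R) * emeasure M (ball a (R * exp (- real k))))"
    by (subst nn_integral_suminf) (auto simp: nn_integral_cmult)
  also have "\<dots> \<le> (\<Sum>k. ennreal (3 * C / (L + real k)\<^sup>2))"
  proof (intro suminf_le)
    fix k
    let ?t = "R * exp (- real k)"
    have t: "0 < ?t" "?t \<le> R" using R by (auto simp: mult_le_cancel_left1)
    have "exp (- 2) \<le> exp (- 1 :: real)" by simp
    with t R have t1: "?t \<le> exp (- 1)" by linarith
    have lnt: "ln ?t = - (L + real k)" using R by (simp add: L_def ln_mult ln_div)
    have "ennreal (exp (real (Suc k)) / R) * emeasure M (ball a ?t) \<le>
        ennreal (exp (real (Suc k)) / R) * ennreal (C * psi ?t)"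
      using t by (intro mult_left_mono dens) auto
    also have "\<dots> = ennreal (exp (real (Suc k)) / R * (C * psi ?t))"
      using R \<open>C \<ge> 0\<close> psi_nonneg by (intro ennreal_mult[symmetric]) auto
    also have "psi ?t = ?t / (L + real k)\<^sup>2"
      by (simp only: psi_eq[OF t(1) t1] lnt power2_minus)
    also have "exp (real (Suc k)) / R * (C * (?t / (L + real k)\<^sup>2)) = exp 1 * C / (L + real k)\<^sup>2"
      using R by (simp add: exp_add exp_minus)
    also have "\<dots> \<le> 3 * C / (L + real k)\<^sup>2"
      using \<open>C \<ge> 0\<close> exp_le by (intro divide_right_mono mult_right_mono) auto
    finally show "ennreal (exp (real (Suc k)) / R) * emeasure M (ball a ?t) \<le> ennreal (3 * C / (L + real k)\<^sup>2)"
      by (simp add: ennreal_leI)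
  qed auto
  also have "\<dots> \<le> ennreal (2 * (3 * C) / L)"
    using L \<open>C \<ge> 0\<close> by (intro suminf_inverse_square_shift_le) auto
  finally show ?thesis by (simp add: L_def)
qed

text \<open>
  The density bound is assumed only at points of \<open>F\<close>, but it controls the restriction of \<open>M\<close> to \<open>F\<close> on
  all balls: a ball that meets \<open>F\<close> at \<open>b\<close> is contained in the ball of twice the radius about \<open>b\<close>. This
  is why the estimate holds at every \<open>x\<close>.
\<close>
lemma nn_integral_log_restrict_le:
  fixes M :: "'a::metric_space measure"
  assumes M: "sets M = sets borel" and F: "F \<in> sets borel"
    and dens: "\<And>b r. b \<in> F \<Longrightarrow> 0 < r \<Longrightarrow> r < R \<Longrightarrow> emeasure M (ball b r) \<le> ennreal (C * psi r)"
    and s: "0 < s" "2 * s < R" "2 * s \<le> exp (- 1)" and "C \<ge> 0"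
  shows "(\<integral>\<^sup>+w. ennreal (ln (s / dist x w)) * indicator F w \<partial>M) \<le> ennreal (2 * C * psi (2 * s))"
proof -
  have [measurable]: "ball x r \<in> sets M" "F \<in> sets M" for r using M F by auto
  have small: "emeasure M (ball x (s / 2 ^ k) \<inter> F) \<le> ennreal (C * psi (2 * s) * (1 / 2) ^ k)" for k
  proof (cases "ball x (s / 2 ^ k) \<inter> F = {}")
    case False
    then obtain b where b: "b \<in> F" "dist x b < s / 2 ^ k" by auto
    define t where "t = 2 * s / 2 ^ k"
    have "(1::real) \<le> 2 ^ k" by simp
    then have t: "0 < t" "t \<le> 2 * s" using s by (auto simp: t_def divide_le_eq mult_le_cancel_left1)
    have "ball x (s / 2 ^ k) \<subseteq> ball b t"
    proof
      fix w assume "w \<in> ball x (s / 2 ^ k)"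
      then show "w \<in> ball b t" using b dist_triangle[of b w x] by (simp add: t_def dist_commute)
    qed
    then have "emeasure M (ball x (s / 2 ^ k) \<inter> F) \<le> emeasure M (ball b t)"
      by (intro emeasure_mono) (auto simp: M)
    also have "\<dots> \<le> ennreal (C * psi t)" using t s by (intro dens b) auto
    also have "psi t \<le> (1 / 2) ^ k * psi (2 * s)"
      using psi_mult_le[of "(1 / 2) ^ k" "2 * s"] s by (simp add: t_def power_one_over power_le_one field_simps)
    then have "ennreal (C * psi t) \<le> ennreal (C * psi (2 * s) * (1 / 2) ^ k)"
      using mult_left_mono[OF _ \<open>C \<ge> 0\<close>, of "psi t" "(1 / 2) ^ k * psi (2 * s)"] by (intro ennreal_leI) (simp add: mult_ac)
    finally show ?thesis .
  qed simp
  have "(\<integral>\<^sup>+w. ennreal (ln (s / dist x w)) * indicator F w \<partial>M) \<le>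
      (\<integral>\<^sup>+w. (\<Sum>k. indicator (ball x (s / 2 ^ k)) w) * indicator F w \<partial>M)"
    by (intro nn_integral_mono mult_right_mono ln_le_sum_indicator_ball s) auto
  also have "\<dots> = (\<integral>\<^sup>+w. (\<Sum>k. indicator (ball x (s / 2 ^ k) \<inter> F) w) \<partial>M)"
    by (simp add: indicator_inter_arith)
  also have "\<dots> = (\<Sum>k. emeasure M (ball x (s / 2 ^ k) \<inter> F))"
    by (subst nn_integral_suminf) auto
  also have "\<dots> \<le> (\<Sum>k. ennreal (C * psi (2 * s) * (1 / 2) ^ k))"
    by (intro suminf_le small) auto
  also have "\<dots> = ennreal (2 * C * psi (2 * s))"
    using \<open>C \<ge> 0\<close> psi_nonneg by (subst suminf_ennreal_half) (auto simp: mult.assoc)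
  finally show ?thesis .
qed

section \<open>The weak capacity quotient\<close>

text \<open>
  A bounded error \<open>h\<close> and a potential are treated separately. For \<open>t \<le> 2 h\<close> the superlevel set is only
  known to be contained in the disc. For \<open>t > 2 h\<close> the potential of \<open>M\<close> is at least \<open>t / 2\<close> on it, and the weak
  type inequality bounds \<open>t\<close> times its capacity by twice the mass of \<open>M\<close>.
\<close>
lemma weak_capacity_quotient_le:
  assumes r: "0 < r" "r \<le> exp (- 1)"
    and M: "sets M = sets borel" "finite_measure M"
    and near: "AE w in M. \<forall>x\<in>ball a r. dist w x \<le> 1"
    and Q: "\<And>x. x \<in> ball a r \<Longrightarrow> x \<in> D \<Longrightarrow> ennreal (Q x) \<le> h + (\<integral>\<^sup>+w. e2ennreal (log_kernel w x) \<partial>M)"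
  shows "(SUP t\<in>{0<..}. ennreal t * capacity {x \<in> ball a r. x \<in> D \<and> Q x > t}) / capacity (ball a r)
    \<le> 2 * h + ennreal (8 * ln (1 / r)) * emeasure M UNIV"
proof -
  let ?cap = "capacity (ball a r)"
  have weak: "ennreal t * capacity {x \<in> ball a r. x \<in> D \<and> Q x > t} \<le> 2 * h * ?cap + 2 * emeasure M UNIV"
    if "t > 0" for t
  proof (cases "ennreal t \<le> 2 * h")
    case True
    have "ennreal t * capacity {x \<in> ball a r. x \<in> D \<and> Q x > t} \<le> 2 * h * ?cap"
      by (intro mult_mono capacity_le_ball r True) auto
    then show ?thesis by (simp add: add_increasing2)
  next
    case False
    have t2: "ennreal t = ennreal (t / 2) + ennreal (t / 2)" using that by (simp add: ennreal_plus[symmetric] del: ennreal_plus)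
    have h: "h \<le> ennreal (t / 2)"
    proof (rule ccontr)
      assume "\<not> h \<le> ennreal (t / 2)"
      then have "ennreal (t / 2) + ennreal (t / 2) \<le> h + h" by (intro add_mono) auto
      then show False using False t2 by (simp add: mult_2)
    qed
    have "ennreal t * compact_capacity K \<le> 2 * emeasure M UNIV"
      if K: "compact K" "K \<subseteq> {x \<in> ball a r. x \<in> D \<and> Q x > t}" for K
    proof -
      have "ennreal (t / 2) * compact_capacity K \<le> emeasure M UNIV"
      proof (rule mult_compact_capacity_le_of_potential_ge[OF M K(1)])
        show "AE w in M. \<forall>x\<in>K. dist w x \<le> 1" using near by eventually_elim (use K in auto)
      next
        fix x assume "x \<in> K"
        then have x: "x \<in> ball a r" "x \<in> D" "t < Q x" using K by auto
        have "ennreal (t / 2) + ennreal (t / 2) \<le> ennreal (Q x)" unfolding t2[symmetric] using x by (intro ennreal_leI) auto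
        also have "\<dots> \<le> ennreal (t / 2) + (\<integral>\<^sup>+w. e2ennreal (log_kernel w x) \<partial>M)"
          using Q[OF x(1,2)] h by (meson add_right_mono order_trans)
        finally show "ennreal (t / 2) \<le> (\<integral>\<^sup>+w. e2ennreal (log_kernel w x) \<partial>M)"
          by (simp add: ennreal_add_left_cancel_le)
      qed
      then have "ennreal (t / 2) * compact_capacity K + ennreal (t / 2) * compact_capacity K \<le> emeasure M UNIV + emeasure M UNIV"
        by (intro add_mono)
      then show ?thesis by (simp add: t2 distrib_right mult_2)
    qed
    then have "ennreal t * capacity {x \<in> ball a r. x \<in> D \<and> Q x > t} \<le> 2 * emeasure M UNIV"
      by (rule mult_capacity_le)
    then show ?thesis by (simp add: add_increasing)
  qed
  have "(SUP t\<in>{0<..}. ennreal t * capacity {x \<in> ball a r. x \<in> D \<and> Q x > t}) / ?cap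
      \<le> (2 * h * ?cap + 2 * emeasure M UNIV) / ?cap"
    by (intro divide_right_mono_ennreal SUP_least weak) auto
  also have "\<dots> = 2 * h * (?cap / ?cap) + 2 * emeasure M UNIV / ?cap"
    by (simp add: add_divide_distrib_ennreal ennreal_times_divide)
  also have "\<dots> \<le> 2 * h * 1 + ennreal (8 * ln (1 / r)) * emeasure M UNIV"
  proof (intro add_mono mult_left_mono)
    show "?cap / ?cap \<le> 1" 
      using ennreal_divide_self[of ?cap] by (cases "?cap = 0"; cases "?cap = top") (auto simp: less_top)
    have "ln r \<le> - 1" using r ln_mono[of r "exp (-1)"] by simp
    moreover have "ln (1 / r) = - ln r" using r by (simp add: ln_div)
    ultimately have L: "ln (1 / r) > 0" by linarith
    have "2 * emeasure M UNIV = ennreal (8 * ln (1 / r) * (1 / (4 * ln (1 / r)))) * emeasure M UNIV"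
      using L by simp
    also have "\<dots> = ennreal (8 * ln (1 / r)) * emeasure M UNIV * ennreal (1 / (4 * ln (1 / r)))"
      using L by (subst ennreal_mult) (auto simp: mult_ac)
    also have "\<dots> \<le> ennreal (8 * ln (1 / r)) * emeasure M UNIV * ?cap"
      by (intro mult_left_mono capacity_ball_ge r) auto
    finally have "2 * emeasure M UNIV \<le> ennreal (8 * ln (1 / r)) * emeasure M UNIV * ?cap" .
    moreover have "0 < ?cap" by (rule less_le_trans[OF _ capacity_ball_ge[OF r]]) (use L in simp)
    ultimately show "2 * emeasure M UNIV / ?cap \<le> ennreal (8 * ln (1 / r)) * emeasure M UNIV"
      by (intro divide_le_posI_ennreal) (simp_all add: mult.commute)
  qed auto
  finally show ?thesis by simp
qed

section \<open>Expansion of the potential at a point\<close>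

text \<open>
  The kernel is infinite on the diagonal, so points of the domain carry no mass.
\<close>
lemma potential_domD:
  assumes "x \<in> potential_dom \<mu>"
  shows "(\<integral>\<^sup>+ w. ennreal \<bar>ln (1 / cmod (x - w))\<bar> \<partial>total_variation \<mu>) < \<infinity>"
    and "emeasure (total_variation \<mu>) {x} = 0"
proof -
  have [measurable_cong]: "sets (total_variation \<mu>) = sets borel" by simp
  have fin: "(\<integral>\<^sup>+ w. e2ennreal \<bar>log_kernel x w\<bar> \<partial>total_variation \<mu>) < \<infinity>"
    using assms by (simp add: potential_dom_def)
  have "(\<integral>\<^sup>+ w. ennreal \<bar>ln (1 / cmod (x - w))\<bar> \<partial>total_variation \<mu>) \<le>
      (\<integral>\<^sup>+ w. e2ennreal \<bar>log_kernel x w\<bar> \<partial>total_variation \<mu>)"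
    by (intro nn_integral_mono) (simp add: log_kernel_def)
  with fin show "(\<integral>\<^sup>+ w. ennreal \<bar>ln (1 / cmod (x - w))\<bar> \<partial>total_variation \<mu>) < \<infinity>"
    by (rule le_less_trans[rotated])
  have "\<infinity> * emeasure (total_variation \<mu>) {x} = (\<integral>\<^sup>+ w. \<infinity> * indicator {x} w \<partial>total_variation \<mu>)"
    by (subst nn_integral_cmult) auto
  also have "\<dots> \<le> (\<integral>\<^sup>+ w. e2ennreal \<bar>log_kernel x w\<bar> \<partial>total_variation \<mu>)"
    by (intro nn_integral_mono) (auto simp: log_kernel_def indicator_def)
  also note fin
  finally show "emeasure (total_variation \<mu>) {x} = 0" by (auto simp: ennreal_top_mult split: if_splits)
qed

lemma nn_integral_inverse_dist_finite:
  fixes a :: "'a::{metric_space, second_countable_topology}"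
  assumes M: "sets M = sets borel" "finite_measure M" and "R > 0" "C \<ge> 0"
    and dens: "\<And>r. 0 < r \<Longrightarrow> r < R \<Longrightarrow> emeasure M (ball a r) \<le> ennreal (C * psi r)"
  shows "(\<integral>\<^sup>+w. ennreal (1 / dist a w) \<partial>M) < \<infinity>" and "emeasure M {a} = 0"
proof -
  interpret finite_measure M by fact
  note [measurable_cong] = M(1)
  have [measurable]: "ball a r \<in> sets M" for r using M by auto
  define \<delta> where "\<delta> = min (R / 2) (exp (- 2))"
  have \<delta>: "0 < \<delta>" "\<delta> < R" "\<delta> \<le> exp (- 2)" using \<open>R > 0\<close> by (auto simp: \<delta>_def)
  have "(\<integral>\<^sup>+w. ennreal (1 / dist a w) \<partial>M) \<le>
      (\<integral>\<^sup>+w. ennreal (1 / dist a w) * indicator (ball a \<delta>) w + ennreal (1 / \<delta>) \<partial>M)"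
  proof (intro nn_integral_mono)
    fix w
    show "ennreal (1 / dist a w) \<le> ennreal (1 / dist a w) * indicator (ball a \<delta>) w + ennreal (1 / \<delta>)"
    proof (cases "w \<in> ball a \<delta>")
      case False
      then have "\<delta> \<le> dist a w" by simp
      then have "1 / dist a w \<le> 1 / \<delta>" using \<delta> by (intro divide_left_mono mult_pos_pos) auto
      then show ?thesis using False by (simp add: ennreal_leI)
    qed simp
  qed
  also have "\<dots> = (\<integral>\<^sup>+w. ennreal (1 / dist a w) * indicator (ball a \<delta>) w \<partial>M) + ennreal (1 / \<delta>) * emeasure M (space M)"
    by (subst nn_integral_add) auto
  also have "\<dots> \<le> ennreal (6 * C / ln (1 / \<delta>)) + ennreal (1 / \<delta>) * emeasure M (space M)"
    using \<delta> by (intro add_right_mono nn_integral_inverse_dist_le M dens \<open>C \<ge> 0\<close>) auto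
  also have "\<dots> < \<infinity>" by (simp add: ennreal_mult_less_top emeasure_eq_measure)
  finally show "(\<integral>\<^sup>+w. ennreal (1 / dist a w) \<partial>M) < \<infinity>" .
  have "emeasure M {a} \<le> 0"
  proof (rule ennreal_le_epsilon)
    fix e :: real assume "e > 0"
    define t where "t = min \<delta> (e / (C + 1))"
    have "exp (- 2) \<le> exp (- 1 :: real)" by simp
    moreover have "t \<le> \<delta>" "t \<le> e / (C + 1)" "0 < t" using \<delta> \<open>e > 0\<close> \<open>C \<ge> 0\<close> by (auto simp: t_def)
    ultimately have t: "0 < t" "t < R" "t \<le> exp (- 1)" "t \<le> e / (C + 1)" using \<delta> by linarith+
    have "emeasure M {a} \<le> emeasure M (ball a t)" using t by (intro emeasure_mono) auto
    also have "\<dots> \<le> ennreal (C * psi t)" using t by (intro dens)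
    also have "C * psi t \<le> (C + 1) * t"
      using psi_le[OF t(1,3)] psi_nonneg[of t] \<open>C \<ge> 0\<close> by (intro mult_mono) auto
    also have "\<dots> \<le> e" using t \<open>C \<ge> 0\<close> by (simp add: field_simps)
    finally show "emeasure M {a} \<le> 0 + ennreal e" by (simp add: ennreal_leI)
  qed
  then show "emeasure M {a} = 0" by simp
qed

lemma mem_potential_dom:
  assumes \<mu>: "finite_signed_measure \<mu>"
    and int: "(\<integral>\<^sup>+ w. ennreal (ln (1 + cmod w)) \<partial>total_variation \<mu>) < \<infinity>"
    and inv: "(\<integral>\<^sup>+w. ennreal (1 / dist a w) \<partial>total_variation \<mu>) < \<infinity>"
    and null: "emeasure (total_variation \<mu>) {a} = 0"
  shows "a \<in> potential_dom \<mu>"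
proof -
  let ?m = "total_variation \<mu>"
  interpret finite_measure ?m by (rule finite_measure_total_variation[OF \<mu>])
  have [measurable_cong]: "sets ?m = sets borel" by simp
  have "AE w in ?m. w \<noteq> a" using null by (intro AE_I[where N = "{a}"]) auto
  then have "AE w in ?m. e2ennreal \<bar>log_kernel a w\<bar> \<le>
      ennreal (1 / dist a w) + (ennreal (ln (1 + cmod a)) + ennreal (ln (1 + cmod w)))"
  proof eventually_elim
    case (elim w)
    let ?d = "dist a w"
    have d: "?d > 0" using elim by auto
    have "?d \<le> cmod a + cmod w" by (simp add: dist_norm norm_triangle_ineq4)
    also have "\<dots> \<le> (1 + cmod a) * (1 + cmod w)" by (simp add: algebra_simps)
    finally have "ln ?d \<le> ln ((1 + cmod a) * (1 + cmod w))" using d by (intro ln_mono) auto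
    also have "\<dots> = ln (1 + cmod a) + ln (1 + cmod w)"
      by (intro ln_mult_pos) (auto intro: add_pos_nonneg)
    finally have up: "ln ?d \<le> ln (1 + cmod a) + ln (1 + cmod w)" .
    have "- ln ?d \<le> 1 / ?d" using ln_le_minus_one[of "1 / ?d"] d by (simp add: ln_div)
    moreover have "0 \<le> 1 / ?d" using d by simp
    moreover have "0 \<le> ln (1 + cmod a)" "0 \<le> ln (1 + cmod w)" by simp_all
    ultimately have "\<bar>ln ?d\<bar> \<le> 1 / ?d + (ln (1 + cmod a) + ln (1 + cmod w))" using up by linarith
    moreover have "e2ennreal \<bar>log_kernel a w\<bar> = ennreal \<bar>ln ?d\<bar>"
      using elim d by (simp add: log_kernel_def dist_norm ln_div)
    ultimately show ?case using d
      by (simp add: ennreal_plus[symmetric] ennreal_leI del: ennreal_plus)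
  qed
  then have "(\<integral>\<^sup>+ w. e2ennreal \<bar>log_kernel a w\<bar> \<partial>?m) \<le>
      (\<integral>\<^sup>+ w. ennreal (1 / dist a w) + (ennreal (ln (1 + cmod a)) + ennreal (ln (1 + cmod w))) \<partial>?m)"
    by (rule nn_integral_mono_AE)
  also have "\<dots> = (\<integral>\<^sup>+w. ennreal (1 / dist a w) \<partial>?m) +
      (ennreal (ln (1 + cmod a)) * emeasure ?m (space ?m) + (\<integral>\<^sup>+ w. ennreal (ln (1 + cmod w)) \<partial>?m))"
    by (simp add: nn_integral_add)
  also have "\<dots> < \<infinity>" using int inv by (simp add: ennreal_mult_less_top emeasure_eq_measure)
  finally show ?thesis by (simp add: potential_dom_def)
qed

text \<open>
  Differentiation under the integral sign gives this value for the derivative of the potential at \<open>a\<close>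
  in the direction \<open>e\<close>; the directions \<open>1\<close> and \<open>\<i>\<close> are those of the two coordinates.
\<close>
definition potential_slope :: "(complex set \<Rightarrow> real) \<Rightarrow> complex \<Rightarrow> complex \<Rightarrow> real" where
  "potential_slope \<mu> a e = signed_integral \<mu> (\<lambda>w. inner e (w - a) / (cmod (w - a))\<^sup>2)"

lemma log_potential_expansion:
  assumes x: "x \<in> potential_dom \<mu>" and a: "a \<in> potential_dom \<mu>"
    and inv: "(\<integral>\<^sup>+w. ennreal (1 / dist a w) \<partial>total_variation \<mu>) < \<infinity>"
  shows "log_potential \<mu> x - log_potential \<mu> a -
      (potential_slope \<mu> a 1 * (Re x - Re a) + potential_slope \<mu> a \<i> * (Im x - Im a)) =
    signed_integral \<mu> (\<lambda>w. log_expansion_remainder (x - a) (w - a))"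
proof -
  let ?k = "\<lambda>z w. ln (1 / cmod (z - w))" and ?g = "\<lambda>e w. inner e (w - a) / (cmod (w - a))\<^sup>2"
  have k: "integrable (upper_variation \<mu>) (?k z)" "integrable (lower_variation \<mu>) (?k z)"
    if "z \<in> potential_dom \<mu>" for z
    using potential_domD(1)[OF that] by (auto intro!: integrable_total_variation)
  have g: "integrable (upper_variation \<mu>) (?g e)" "integrable (lower_variation \<mu>) (?g e)"
    if e: "cmod e = 1" for e
  proof -
    have "(\<integral>\<^sup>+w. ennreal \<bar>?g e w\<bar> \<partial>total_variation \<mu>) \<le> (\<integral>\<^sup>+w. ennreal (1 / dist a w) \<partial>total_variation \<mu>)"
    proof (intro nn_integral_mono ennreal_leI)
      fix w
      have "\<bar>?g e w\<bar> \<le> cmod e * cmod (w - a) / (cmod (w - a))\<^sup>2"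
        unfolding abs_divide abs_power2 by (intro divide_right_mono Cauchy_Schwarz_ineq2) simp
      also have "\<dots> = 1 / dist a w" using e by (simp add: power2_eq_square dist_norm norm_minus_commute)
      finally show "\<bar>?g e w\<bar> \<le> 1 / dist a w" .
    qed
    also note inv
    finally have "(\<integral>\<^sup>+w. ennreal \<bar>?g e w\<bar> \<partial>total_variation \<mu>) < \<infinity>" .
    then show "integrable (upper_variation \<mu>) (?g e)" "integrable (lower_variation \<mu>) (?g e)"
      by (auto intro!: integrable_total_variation)
  qed
  have "inner (x - a) (w - a) / (cmod (w - a))\<^sup>2 = ?g 1 w * (Re x - Re a) + ?g \<i> w * (Im x - Im a)" for w
    by (simp add: inner_complex_def add_divide_distrib mult.commute)
  then have eq: "log_expansion_remainder (x - a) (w - a) =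
      ?k x w - ?k a w - (?g 1 w * (Re x - Re a) + ?g \<i> w * (Im x - Im a))" for w
    by (simp add: log_expansion_remainder_def norm_minus_commute[of a w])
  have lin: "(LINT w|M. p w - q w - (s w * \<alpha> + t w * \<beta>)) =
      (LINT w|M. p w) - (LINT w|M. q w) - ((LINT w|M. s w) * \<alpha> + (LINT w|M. t w) * \<beta>)"
    if "integrable M p" "integrable M q" "integrable M s" "integrable M t"
    for M :: "complex measure" and p q s t :: "complex \<Rightarrow> real" and \<alpha> \<beta>
    using that by simp
  show ?thesis
    unfolding eq log_potential_def potential_slope_def signed_integral_def
    using k[OF x] k[OF a] g[of 1] g[of \<i>]
    by (subst (1 2) lin) (simp_all only: norm_one norm_ii algebra_simps)
qed

text \<open>
  Integration of the kernel estimate. The logarithmic singularity is split according to whether \<open>w\<close>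
  belongs to \<open>F\<close>: the part on \<open>F\<close> is uniformly small by \<open>nn_integral_log_restrict_le\<close>, whereas the part
  off \<open>F\<close> is kept as the potential of a measure of density \<open>2 / dist a w\<close>. The weight comes from
  dividing by \<open>dist x a\<close>, which exceeds \<open>dist a w / 2\<close> where the singular term occurs.
\<close>
lemma diff_quot_log_potential_le:
  fixes \<mu> :: "complex set \<Rightarrow> real"
  defines "m \<equiv> total_variation \<mu>"
  assumes F [measurable]: "F \<in> sets borel" and "C \<ge> 0"
    and dens: "\<And>b r. b \<in> F \<Longrightarrow> 0 < r \<Longrightarrow> r < R \<Longrightarrow> emeasure m (ball b r) \<le> ennreal (C * psi r)"
    and r: "0 < r" "4 * r \<le> R" "4 * r \<le> exp (- 1)"
    and x: "x \<in> potential_dom \<mu>" "x \<in> ball a r" and a: "a \<in> potential_dom \<mu>"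
    and inv: "(\<integral>\<^sup>+w. ennreal (1 / dist a w) \<partial>m) < \<infinity>"
  shows "ennreal (diff_quot (log_potential \<mu>) a (potential_slope \<mu> a 1) (potential_slope \<mu> a \<i>) x) \<le>
    13 * (\<integral>\<^sup>+w. ennreal (1 / dist a w * min 1 (r / dist a w)) \<partial>m) + ennreal (8 * C / (ln (4 * r))\<^sup>2) +
    (\<integral>\<^sup>+w. e2ennreal (log_kernel w x)
      \<partial>density m (\<lambda>w. ennreal (2 / dist a w) * indicator (ball a (2 * r) - F) w))"
proof (cases "x = a")
  case True
  then show ?thesis by (simp add: diff_quot_def)
next
  case False
  have [measurable_cong]: "sets m = sets borel" by (simp add: m_def)
  have [measurable]: "ball z t \<in> sets borel" for z :: complex and t by simp
  define \<rho> where "\<rho> = dist x a"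
  have \<rho>: "0 < \<rho>" "\<rho> < r" using False x by (auto simp: \<rho>_def dist_commute)
  have "exp (- 1) < (1::real)" by simp
  then have r1: "4 * r < 1" using r by linarith
  let ?rem = "\<lambda>w. log_expansion_remainder (x - a) (w - a)"
  let ?I = "\<lambda>w. ennreal (1 / dist a w * min 1 (r / dist a w))"
  let ?G = "\<lambda>w. ennreal (2 / dist a w) * indicator (ball a (2 * r) - F) w"
  have "AE w in m. w \<noteq> a"
    using potential_domD(2)[OF a] by (intro AE_I[where N = "{a}"]) (auto simp: m_def)
  moreover have "AE w in m. w \<noteq> x"
    using potential_domD(2)[OF x(1)] by (intro AE_I[where N = "{x}"]) (auto simp: m_def)
  ultimately have ptw: "AE w in m. ennreal \<bar>?rem w\<bar> \<le> ennreal \<rho> * (13 * ?I w) +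
      (ennreal (ln (2 * \<rho> / dist x w)) * indicator F w + ennreal \<rho> * (?G w * e2ennreal (log_kernel w x)))"
  proof eventually_elim
    case (elim w)
    define d where "d = dist a w"
    define z where "z = ln (2 * \<rho> / dist x w)"
    have d: "d > 0" "dist x w > 0" using elim by (auto simp: d_def)
    have "norm (x - a) = \<rho>" "norm (w - a) = d" "norm (x - a - (w - a)) = dist x w"
      by (auto simp: \<rho>_def d_def dist_norm norm_minus_commute)
    note norms = this
    have "\<bar>?rem w\<bar> \<le> 13 * (\<rho> / d) * min 1 (\<rho> / d) + (if d < 2 * \<rho> then max 0 z else 0)"
      using log_expansion_remainder_bound[of "x - a" "w - a", unfolded norms] False elim
      by (simp add: z_def split: if_split_asm if_split)
    also have "13 * (\<rho> / d) * min 1 (\<rho> / d) \<le> 13 * (\<rho> / d) * min 1 (r / d)"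
      using \<rho> d by (intro mult_left_mono min.mono divide_right_mono) auto
    finally have "ennreal \<bar>?rem w\<bar> \<le> ennreal (13 * (\<rho> / d) * min 1 (r / d) + (if d < 2 * \<rho> then max 0 z else 0))"
      by (intro ennreal_leI) simp
    also have "\<dots> = ennreal (\<rho> * (13 * (1 / d * min 1 (r / d)))) + ennreal (if d < 2 * \<rho> then max 0 z else 0)"
      using \<rho> d r by (subst ennreal_plus) (auto simp: mult_ac)
    also have "ennreal (\<rho> * (13 * (1 / d * min 1 (r / d)))) = ennreal \<rho> * (13 * ?I w)"
      using \<rho> d r unfolding d_def[symmetric] by (subst ennreal_mult, simp, simp, subst ennreal_mult) auto
    also have "ennreal (if d < 2 * \<rho> then max 0 z else 0) \<le>
        ennreal z * indicator F w + ennreal \<rho> * (?G w * e2ennreal (log_kernel w x))"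
    proof (cases "d < 2 * \<rho> \<and> 0 < z \<and> w \<notin> F")
      case True
      \<comment> \<open>Here \<open>1 \<le> \<rho> (2 / d)\<close> supplies the weight, and \<open>2 \<rho> \<le> 1\<close> compares with the kernel.\<close>
      have "2 * \<rho> / dist x w \<le> 1 / dist x w" using \<rho> r1 d by (intro divide_right_mono) auto
      then have "z \<le> ln (1 / dist x w)" unfolding z_def using \<rho> d by (intro ln_mono) auto
      then have "1 * z \<le> (\<rho> * (2 / d)) * ln (1 / dist x w)"
        using True d \<rho> by (intro mult_mono) auto
      then have "ennreal z \<le> ennreal (\<rho> * (2 / d) * ln (1 / dist x w))" by (intro ennreal_leI) simp
      also have "\<dots> = ennreal \<rho> * (ennreal (2 / d) * ennreal (ln (1 / dist x w)))"
        using \<rho> d by (subst mult.assoc, subst ennreal_mult', simp, subst ennreal_mult') auto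
      also have "ennreal (2 / d) = ?G w" using True \<rho> by (simp add: d_def)
      also have "ennreal (ln (1 / dist x w)) = e2ennreal (log_kernel w x)"
        using elim by (simp add: log_kernel_def dist_norm norm_minus_commute)
      finally show ?thesis using True by simp
    next
      case False
      then show ?thesis by (auto simp: max_def ennreal_neg intro: add_increasing2 split: split_indicator)
    qed
    finally show ?case by (simp add: z_def add_left_mono)
  qed
  have "ennreal \<bar>signed_integral \<mu> ?rem\<bar> \<le> (\<integral>\<^sup>+w. ennreal \<bar>?rem w\<bar> \<partial>m)"
    unfolding m_def by (rule signed_integral_bound) (simp add: log_expansion_remainder_def)
  also have "\<dots> \<le> (\<integral>\<^sup>+w. ennreal \<rho> * (13 * ?I w) +
      (ennreal (ln (2 * \<rho> / dist x w)) * indicator F w + ennreal \<rho> * (?G w * e2ennreal (log_kernel w x))) \<partial>m)"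
    by (rule nn_integral_mono_AE[OF ptw])
  also have "\<dots> = ennreal \<rho> * (13 * (\<integral>\<^sup>+w. ?I w \<partial>m)) +
      ((\<integral>\<^sup>+w. ennreal (ln (2 * \<rho> / dist x w)) * indicator F w \<partial>m) +
       ennreal \<rho> * (\<integral>\<^sup>+w. ?G w * e2ennreal (log_kernel w x) \<partial>m))"
    by (simp add: nn_integral_add nn_integral_cmult)
  also have "(\<integral>\<^sup>+w. ?G w * e2ennreal (log_kernel w x) \<partial>m) = (\<integral>\<^sup>+w. e2ennreal (log_kernel w x) \<partial>density m ?G)"
    by (subst nn_integral_density) auto
  also have "(\<integral>\<^sup>+w. ennreal (ln (2 * \<rho> / dist x w)) * indicator F w \<partial>m) \<le> ennreal \<rho> * ennreal (8 * C / (ln (4 * r))\<^sup>2)"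
  proof -
    have "(\<integral>\<^sup>+w. ennreal (ln (2 * \<rho> / dist x w)) * indicator F w \<partial>m) \<le> ennreal (2 * C * psi (2 * (2 * \<rho>)))"
      by (rule nn_integral_log_restrict_le[OF _ F dens]) (use \<rho> r \<open>C \<ge> 0\<close> in \<open>auto simp: m_def\<close>)
    also have "psi (2 * (2 * \<rho>)) = 4 * \<rho> / (ln (4 * \<rho>))\<^sup>2" using \<rho> r by (subst psi_eq) auto
    also have "ennreal (2 * C * (4 * \<rho> / (ln (4 * \<rho>))\<^sup>2)) \<le> ennreal (\<rho> * (8 * C / (ln (4 * r))\<^sup>2))"
    proof (rule ennreal_leI)
      have "ln (4 * r) \<le> - 1" using r ln_mono[of "4 * r" "exp (-1)"] by simp
      moreover have "ln (4 * \<rho>) \<le> ln (4 * r)" using \<rho> by (intro ln_mono) auto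
      ultimately have "\<bar>ln (4 * r)\<bar> \<le> \<bar>ln (4 * \<rho>)\<bar>" and neg: "ln (4 * r) < 0" "ln (4 * \<rho>) < 0" by linarith+
      then have "(ln (4 * r))\<^sup>2 \<le> (ln (4 * \<rho>))\<^sup>2" by (simp only: abs_le_square_iff)
      then have "\<rho> * (8 * C) / (ln (4 * \<rho>))\<^sup>2 \<le> \<rho> * (8 * C) / (ln (4 * r))\<^sup>2"
        using \<rho> \<open>C \<ge> 0\<close> neg by (intro divide_left_mono mult_pos_pos) auto
      then show "2 * C * (4 * \<rho> / (ln (4 * \<rho>))\<^sup>2) \<le> \<rho> * (8 * C / (ln (4 * r))\<^sup>2)" by (simp add: mult_ac)
    qed
    also have "\<dots> = ennreal \<rho> * ennreal (8 * C / (ln (4 * r))\<^sup>2)" using \<rho> \<open>C \<ge> 0\<close> by (intro ennreal_mult) auto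
    finally show ?thesis .
  qed
  finally have "ennreal \<bar>signed_integral \<mu> ?rem\<bar> \<le> ennreal \<rho> * (13 * (\<integral>\<^sup>+w. ?I w \<partial>m) +
      ennreal (8 * C / (ln (4 * r))\<^sup>2) + (\<integral>\<^sup>+w. e2ennreal (log_kernel w x) \<partial>density m ?G))"
    by (simp add: distrib_left add.assoc add_mono)
  then have "ennreal \<bar>signed_integral \<mu> ?rem\<bar> / ennreal \<rho> \<le> 13 * (\<integral>\<^sup>+w. ?I w \<partial>m) +
      ennreal (8 * C / (ln (4 * r))\<^sup>2) + (\<integral>\<^sup>+w. e2ennreal (log_kernel w x) \<partial>density m ?G)"
    using \<rho> by (intro divide_le_posI_ennreal) auto
  then show ?thesis
    using \<rho> log_potential_expansion[OF x(1) a inv[unfolded m_def]]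
    by (simp add: divide_ennreal diff_quot_def \<rho>_def dist_norm)
qed

text \<open>
  Close to \<open>a\<close> the minimum is replaced by 1, because there the integral of \<open>1 / dist a w\<close> is small;
  at distance at least \<open>\<delta>\<close> the integrand is at most \<open>r / \<delta>\<^sup>2\<close>.
\<close>
lemma nn_integral_inverse_dist_min_le:
  fixes a :: "'a::{metric_space, second_countable_topology}"
  assumes M: "sets M = sets borel" "finite_measure M" and \<delta>: "0 < \<delta>" "\<delta> \<le> exp (- 2)" and "C \<ge> 0" "r > 0"
    and dens: "\<And>r. 0 < r \<Longrightarrow> r \<le> \<delta> \<Longrightarrow> emeasure M (ball a r) \<le> ennreal (C * psi r)"
  shows "(\<integral>\<^sup>+w. ennreal (1 / dist a w * min 1 (r / dist a w)) \<partial>M) \<le>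
    ennreal (6 * C / ln (1 / \<delta>) + r / \<delta>\<^sup>2 * measure M UNIV)"
proof -
  interpret finite_measure M by fact
  note [measurable_cong] = M(1)
  have [measurable]: "ball a r \<in> sets M" for r using M by auto
  have sp: "space M = UNIV" using sets_eq_imp_space_eq[OF M(1)] by simp
  have "(\<integral>\<^sup>+w. ennreal (1 / dist a w * min 1 (r / dist a w)) \<partial>M) \<le>
      (\<integral>\<^sup>+w. ennreal (1 / dist a w) * indicator (ball a \<delta>) w + ennreal (r / \<delta>\<^sup>2) \<partial>M)"
  proof (intro nn_integral_mono)
    fix w
    show "ennreal (1 / dist a w * min 1 (r / dist a w)) \<le> ennreal (1 / dist a w) * indicator (ball a \<delta>) w + ennreal (r / \<delta>\<^sup>2)"
    proof (cases "w \<in> ball a \<delta>")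
      case True
      have "1 / dist a w * min 1 (r / dist a w) \<le> 1 / dist a w * 1" by (intro mult_left_mono) auto
      then show ?thesis using True by (auto intro!: add_increasing2 ennreal_leI)
    next
      case False
      then have "\<delta> \<le> dist a w" by simp
      then have "1 / dist a w * min 1 (r / dist a w) \<le> 1 / \<delta> * (r / \<delta>)"
        using \<delta> \<open>r > 0\<close> by (intro mult_mono divide_left_mono min.coboundedI2 mult_pos_pos) auto
      then show ?thesis using False by (auto simp: power2_eq_square intro!: ennreal_leI)
    qed
  qed
  also have "\<dots> = (\<integral>\<^sup>+w. ennreal (1 / dist a w) * indicator (ball a \<delta>) w \<partial>M) + ennreal (r / \<delta>\<^sup>2) * emeasure M UNIV"
    by (subst nn_integral_add) (auto simp: sp)
  also have "\<dots> \<le> ennreal (6 * C / ln (1 / \<delta>)) + ennreal (r / \<delta>\<^sup>2) * emeasure M UNIV"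
    using \<delta> by (intro add_right_mono nn_integral_inverse_dist_le M dens \<open>C \<ge> 0\<close>) auto
  also have "\<dots> = ennreal (6 * C / ln (1 / \<delta>) + r / \<delta>\<^sup>2 * measure M UNIV)"
  proof -
    have "exp (- 2) < (1::real)" by simp
    then have "\<delta> < 1" using \<delta> by linarith
    then show ?thesis using \<delta> \<open>r > 0\<close> \<open>C \<ge> 0\<close>
      by (subst ennreal_plus) (auto simp: emeasure_eq_measure ennreal_mult[symmetric])
  qed
  finally show ?thesis .
qed

section \<open>Capacity differentiability at points of vanishing exterior density\<close>

text \<open>
  The density of the full measure is only bounded at \<open>a\<close>, but the part off \<open>F\<close> has density 0 there. The
  measure that remains in the weak type estimate therefore has mass \<open>o (1 / ln (1 / r))\<close>, which is
  negligible against the capacity of the disc of radius \<open>r\<close>.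
\<close>
lemma capacity_differentiable_log_potential:
  fixes \<mu> :: "complex set \<Rightarrow> real"
  defines "m \<equiv> total_variation \<mu>"
  assumes \<mu>: "finite_signed_measure \<mu>"
    and int: "(\<integral>\<^sup>+ w. ennreal (ln (1 + cmod w)) \<partial>m) < \<infinity>"
    and F: "F \<in> sets borel" "a \<in> F" and C: "C \<ge> 0" and R: "R > 0"
    and dens: "\<And>b r. b \<in> F \<Longrightarrow> 0 < r \<Longrightarrow> r < R \<Longrightarrow> emeasure m (ball b r) \<le> ennreal (C * psi r)"
    and ext: "\<And>\<eta>. \<eta> > 0 \<Longrightarrow> \<exists>\<rho>>0. \<forall>r. 0 < r \<longrightarrow> r < \<rho> \<longrightarrow>
      emeasure (density m (indicator (- F))) (ball a r) \<le> ennreal (\<eta> * psi r)"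
  shows "capacity_differentiable (potential_dom \<mu>) (log_potential \<mu>) a"
proof -
  have sets [measurable_cong, simp]: "sets m = sets borel" by (simp add: m_def)
  have [measurable]: "F \<in> sets borel" "ball z t \<in> sets borel" for z :: complex and t using F by auto
  interpret finite_measure m unfolding m_def by (rule finite_measure_total_variation[OF \<mu>])
  have inv: "(\<integral>\<^sup>+w. ennreal (1 / dist a w) \<partial>m) < \<infinity>" and null: "emeasure m {a} = 0"
    using nn_integral_inverse_dist_finite[OF sets finite_measure_axioms R C dens[OF F(2)]] by auto
  have a: "a \<in> potential_dom \<mu>" using mem_potential_dom \<mu> int inv null unfolding m_def by blast
  define G where "G r = (SUP t\<in>{0<..}. ennreal t * capacity {x \<in> ball a r. x \<in> potential_dom \<mu> \<and>
      diff_quot (log_potential \<mu>) a (potential_slope \<mu> a 1) (potential_slope \<mu> a \<i>) x > t}) / capacity (ball a r)" for r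
  define c where "c = measure m UNIV"
  \<comment> \<open>Twice the uniform error of the expansion; it does not depend on \<open>\<eta>\<close>.\<close>
  define g where "g r = 2 * (13 * (6 * C / ln (1 / sqrt (sqrt r)) + r / (sqrt (sqrt r))\<^sup>2 * c) + 8 * C / (ln (4 * r))\<^sup>2)" for r
  have G_le: "\<forall>\<^sub>F r in at_right 0. G r \<le> ennreal (g r + 192 * \<eta>)" if "\<eta> > 0" for \<eta>
  proof -
    obtain \<rho> where \<rho>: "\<rho> > 0" "\<And>r. 0 < r \<Longrightarrow> r < \<rho> \<Longrightarrow>
        emeasure (density m (indicator (- F))) (ball a r) \<le> ennreal (\<eta> * psi r)"
      using ext[OF \<open>\<eta> > 0\<close>] by blast
    have "((\<lambda>r::real. sqrt (sqrt r)) \<longlongrightarrow> 0) (at_right 0)" by real_asymp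
    then have "\<forall>\<^sub>F r in at_right 0. sqrt (sqrt r) < min R (exp (- 2))"
      by (rule order_tendstoD) (use R in auto)
    moreover have "\<forall>\<^sub>F r in at_right 0. r \<in> {0<..<min (R / 4) (min (\<rho> / 2) (exp (- 2) / 4))}"
      by (rule eventually_at_right_real) (use R \<rho> in auto)
    ultimately show ?thesis
    proof eventually_elim
      case (elim r)
      have e2: "exp (- 2) \<le> exp (- 1 :: real)" "exp (- 2) \<le> 1 / (4::real)"
        using exp_ge_add_one_self[of "1::real"] mult_mono[of 2 "exp 1" 2 "exp 1 :: real"]
        by (auto simp: exp_minus divide_simps exp_add[symmetric])
      have r: "0 < r" "4 * r < R" "2 * r < \<rho>" "4 * r < exp (- 2)" using elim(2) by auto
      then have r': "4 * r \<le> exp (- 1)" "r \<le> exp (- 1)" "2 * r \<le> exp (- 2)" "16 * r < 1" using e2 by linarith+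
      \<comment> \<open>With the fourth root both \<open>1 / ln (1 / \<delta>)\<close> and \<open>r / \<delta>\<^sup>2\<close> tend to 0 with \<open>r\<close>.\<close>
      define \<delta> where "\<delta> = sqrt (sqrt r)"
      have \<delta>: "0 < \<delta>" "\<delta> < R" "\<delta> \<le> exp (- 2)" using elim(1) r by (auto simp: \<delta>_def)
      define h where "h = 13 * (\<integral>\<^sup>+w. ennreal (1 / dist a w * min 1 (r / dist a w)) \<partial>m) + ennreal (8 * C / (ln (4 * r))\<^sup>2)"
      define M where "M = density m (\<lambda>w. ennreal (2 / dist a w) * indicator (ball a (2 * r) - F) w)"
      have Msets: "sets M = sets borel" by (simp add: M_def)
      \<comment> \<open>The exterior measure lives on the ball of radius \<open>2 r\<close>, the capacity is that of radius \<open>r\<close>.\<close>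
      have lnr: "ln (1 / (2 * r)) \<ge> ln (1 / r) / 2" "ln (1 / r) > 0"
      proof -
        have "ln (1 / r) = ln (sqrt (1 / r) * sqrt (1 / r))" using r by simp
        also have "\<dots> = 2 * ln (sqrt (1 / r))" using r by (subst ln_mult) auto
        finally have "ln (1 / r) / 2 = ln (sqrt (1 / r))" by simp
        also have "\<dots> \<le> ln (1 / (2 * r))"
        proof (rule ln_mono)
          have "sqrt (1 / r) \<le> sqrt ((1 / (2 * r))\<^sup>2)"
            using r r' by (intro real_sqrt_le_mono) (simp add: power2_eq_square field_simps)
          then show "sqrt (1 / r) \<le> 1 / (2 * r)" using r by simp
        qed (use r in auto)
        finally show "ln (1 / (2 * r)) \<ge> ln (1 / r) / 2" .
        show "ln (1 / r) > 0" using r r' by simp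
      qed
      have "emeasure M UNIV = (\<integral>\<^sup>+w. ennreal (2 / dist a w) * indicator (ball a (2 * r) - F) w \<partial>m)"
        by (simp add: M_def emeasure_density)
      also have "\<dots> = (\<integral>\<^sup>+w. 2 * (indicator (- F) w * (ennreal (1 / dist a w) * indicator (ball a (2 * r)) w)) \<partial>m)"
      proof (intro nn_integral_cong)
        fix w
        have "ennreal (2 / dist a w) = 2 * ennreal (1 / dist a w)"
          using ennreal_mult'[of 2 "1 / dist a w"] by simp
        then show "ennreal (2 / dist a w) * indicator (ball a (2 * r) - F) w =
            2 * (indicator (- F) w * (ennreal (1 / dist a w) * indicator (ball a (2 * r)) w))"
          by (auto split: split_indicator)
      qed
      also have "\<dots> = 2 * (\<integral>\<^sup>+w. ennreal (1 / dist a w) * indicator (ball a (2 * r)) w \<partial>density m (indicator (- F)))"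
        by (subst nn_integral_cmult) (auto simp: nn_integral_density)
      also have "\<dots> \<le> 2 * ennreal (6 * \<eta> / ln (1 / (2 * r)))"
        using r r' \<open>\<eta> > 0\<close> by (intro mult_left_mono nn_integral_inverse_dist_le \<rho>(2)) auto
      also have "\<dots> = ennreal (12 * \<eta> / ln (1 / (2 * r)))"
        using ennreal_mult'[of 2 "6 * \<eta> / ln (1 / (2 * r))"] by simp
      also have "\<dots> \<le> ennreal (12 * \<eta> / (ln (1 / r) / 2))"
        using lnr \<open>\<eta> > 0\<close> by (intro ennreal_leI divide_left_mono) auto
      finally have Mass: "emeasure M UNIV \<le> ennreal (24 * \<eta> / ln (1 / r))" by simp
      have "space M = UNIV" using sets_eq_imp_space_eq[OF Msets] by simp
      then have "finite_measure M" using Mass by (intro finite_measureI) (auto simp: top_unique)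
      have inball: "AE w in M. w \<in> ball a (2 * r)"
        unfolding M_def by (subst AE_density) (auto split: split_indicator_asm)
      have near: "AE w in M. \<forall>x\<in>ball a r. dist w x \<le> 1"
        using inball
      proof eventually_elim
        case (elim w)
        show ?case
        proof
          fix x assume "x \<in> ball a r"
          then show "dist w x \<le> 1" using elim r'(4) r(1) dist_triangle[of w x a] by (simp add: dist_commute)
        qed
      qed
      have "G r \<le> 2 * h + ennreal (8 * ln (1 / r)) * emeasure M UNIV"
        unfolding G_def
      proof (rule weak_capacity_quotient_le[OF r(1) r'(2) Msets \<open>finite_measure M\<close> near])
        fix x assume x: "x \<in> ball a r" "x \<in> potential_dom \<mu>"
        show "ennreal (diff_quot (log_potential \<mu>) a (potential_slope \<mu> a 1) (potential_slope \<mu> a \<i>) x)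
            \<le> h + (\<integral>\<^sup>+w. e2ennreal (log_kernel w x) \<partial>M)"
          unfolding h_def M_def m_def
          by (rule diff_quot_log_potential_le[OF F(1) C dens[unfolded m_def] r(1) less_imp_le[OF r(2)] r'(1) x(2,1) a inv[unfolded m_def]])
      qed
      moreover have "h \<le> ennreal (g r / 2)"
      proof -
        have "exp (- 2) < (1::real)" by simp
        then have "\<delta> < 1" using \<delta> by linarith
        then have p: "0 \<le> 6 * C / ln (1 / \<delta>) + r / \<delta>\<^sup>2 * c" using \<delta> r C by (auto simp: c_def)
        have "h \<le> 13 * ennreal (6 * C / ln (1 / \<delta>) + r / \<delta>\<^sup>2 * c) + ennreal (8 * C / (ln (4 * r))\<^sup>2)"
          unfolding h_def c_def using \<delta> r C F(2)
          by (intro add_right_mono mult_left_mono nn_integral_inverse_dist_min_le dens finite_measure_axioms) auto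
        also have "13 * ennreal (6 * C / ln (1 / \<delta>) + r / \<delta>\<^sup>2 * c) = ennreal (13 * (6 * C / ln (1 / \<delta>) + r / \<delta>\<^sup>2 * c))"
          using ennreal_mult[OF _ p, of 13] by simp
        also have "\<dots> + ennreal (8 * C / (ln (4 * r))\<^sup>2) =
            ennreal (13 * (6 * C / ln (1 / \<delta>) + r / \<delta>\<^sup>2 * c) + 8 * C / (ln (4 * r))\<^sup>2)"
          using p C by (intro ennreal_plus[symmetric]) auto
        also have "13 * (6 * C / ln (1 / \<delta>) + r / \<delta>\<^sup>2 * c) + 8 * C / (ln (4 * r))\<^sup>2 = g r / 2"
          unfolding g_def \<delta>_def by (rule nonzero_mult_div_cancel_left[symmetric]) simp
        finally show ?thesis .
      qed
      moreover have "ennreal (8 * ln (1 / r)) * emeasure M UNIV \<le> ennreal (192 * \<eta>)"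
      proof -
        have "ennreal (8 * ln (1 / r)) * emeasure M UNIV \<le> ennreal (8 * ln (1 / r)) * ennreal (24 * \<eta> / ln (1 / r))"
          by (intro mult_left_mono Mass) auto
        also have "\<dots> = ennreal (192 * \<eta>)" using lnr \<open>\<eta> > 0\<close> by (subst ennreal_mult[symmetric]) auto
        finally show ?thesis .
      qed
      ultimately have "G r \<le> 2 * ennreal (g r / 2) + ennreal (192 * \<eta>)"
        by (meson add_mono mult_left_mono order_trans zero_le)
      also have "2 * ennreal (g r / 2) = ennreal (g r)" using ennreal_mult'[of 2 "g r / 2"] by simp
      also have "ennreal (g r) + ennreal (192 * \<eta>) = ennreal (g r + 192 * \<eta>)"
      proof (rule ennreal_plus[symmetric])
        have "exp (- 2) < (1::real)" by simp
        then have "\<delta> < 1" using \<delta> by linarith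
        then show "0 \<le> g r" using \<delta> r C by (auto simp: g_def \<delta>_def[symmetric] c_def)
      qed (use \<open>\<eta> > 0\<close> in simp)
      finally show ?case .
    qed
  qed
  have "(g \<longlongrightarrow> 0) (at_right 0)" unfolding g_def by real_asymp
  have "(G \<longlongrightarrow> 0) (at_right 0)"
  proof (rule order_tendstoI)
    fix b :: ennreal assume "0 < b"
    then obtain e where e: "0 < e" "ennreal e \<le> b"
      by (cases b) (auto intro: that[of 1])
    have "\<forall>\<^sub>F r in at_right 0. g r < e / 2"
      by (rule order_tendstoD[OF \<open>(g \<longlongrightarrow> 0) (at_right 0)\<close>]) (use e in simp)
    moreover have "\<forall>\<^sub>F r in at_right 0. G r \<le> ennreal (g r + 192 * (e / 400))"
      by (rule G_le) (use e in simp)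
    ultimately show "\<forall>\<^sub>F r in at_right 0. G r < b"
    proof eventually_elim
      case (elim r)
      have "g r + 192 * (e / 400) < e" using elim(1) e by simp
      then have "ennreal (g r + 192 * (e / 400)) < ennreal e" using e by (intro ennreal_lessI)
      then show ?case using elim(2) e by order
    qed
  qed simp
  then show ?thesis using a unfolding capacity_differentiable_def G_def by blast
qed

theorem theorem4:
  fixes \<mu> :: "complex set \<Rightarrow> real"
  assumes "finite_signed_measure \<mu>"
    and "(\<integral>\<^sup>+ w. ennreal (ln (1 + cmod w)) \<partial>total_variation \<mu>) < \<infinity>"
  shows "hausdorff_measure psi
           {a. \<not> capacity_differentiable (potential_dom \<mu>) (log_potential \<mu>) a} = 0"
proof -
  let ?m = "total_variation \<mu>"
  let ?F = "psi_bounded_set ?m"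
  interpret finite_measure ?m by (rule finite_measure_total_variation[OF assms(1)])
  have F: "?F N \<in> sets borel" for N
    by (intro borel_closed closed_psi_bounded_set) simp
  define Z where "Z N = {a \<in> ?F N. \<not> (\<forall>\<eta>>0. \<exists>\<rho>>0. \<forall>r. 0 < r \<longrightarrow> r < \<rho> \<longrightarrow>
      emeasure (density ?m (indicator (- ?F N))) (ball a r) \<le> ennreal (\<eta> * psi r))}" for N
  \<comment> \<open>Almost every point lies in some \<open>?F N\<close>, and the mass off \<open>?F N\<close> has density 0 there.\<close>
  define E where "E n = (case n of 0 \<Rightarrow> - (\<Union>N. ?F N) | Suc N \<Rightarrow> Z N)" for n
  have Z0: "hausdorff_measure psi (Z N) = 0" for N
    unfolding Z_def
  proof (rule hausdorff_measure_psi_dense_null_set_eq_0)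
    show "sets (density ?m (indicator (- ?F N))) = sets borel" by simp
    show "finite_measure (density ?m (indicator (- ?F N)))"
      using F[of N] by (intro finite_measure_restricted) auto
    show "emeasure (density ?m (indicator (- ?F N))) (?F N) = 0"
      using F[of N] by (subst emeasure_restricted) auto
  qed (rule F)
  have "hausdorff_measure psi (E n) = 0" for n
  proof (cases n)
    case 0
    show ?thesis unfolding E_def 0 nat.case
      by (rule hausdorff_measure_psi_unbounded_eq_0) (simp_all add: finite_measure_axioms)
  qed (simp add: E_def Z0)
  then have null: "hausdorff_measure psi (\<Union>n. E n) = 0" by (rule hausdorff_measure_0_UN)
  show ?thesis
  proof (rule hausdorff_measure_0_mono[OF null], rule subsetI, rule ccontr)
    fix a assume bad: "a \<in> {a. \<not> capacity_differentiable (potential_dom \<mu>) (log_potential \<mu>) a}"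
      and "a \<notin> (\<Union>n. E n)"
    then have aE: "a \<notin> E n" for n by blast
    from aE[of 0] obtain N where N: "a \<in> ?F N" by (auto simp: E_def)
    have "\<exists>\<rho>>0. \<forall>r. 0 < r \<longrightarrow> r < \<rho> \<longrightarrow>
        emeasure (density ?m (indicator (- ?F N))) (ball a r) \<le> ennreal (\<eta> * psi r)" if "\<eta> > 0" for \<eta>
    proof -
      have "a \<notin> Z N" using aE[of "Suc N"] by (simp add: E_def)
      then show ?thesis unfolding Z_def using N that by blast
    qed
    then have "capacity_differentiable (potential_dom \<mu>) (log_potential \<mu>) a"
      using assms N by (intro capacity_differentiable_log_potential[where F = "?F N" and C = "real N" and R = "1 / real (Suc N)"] F)
        (auto simp: psi_bounded_set_def)
    then show False using bad by simp
  qed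
qed

end
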